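(* Let $(\mathcal X,\mathfrak S)$ be a hierarchical space. For each $\kappa\ge1$ there exist $\theta_e,\theta_u\ge0$ such that the following holds. Let $\vec b\in\prod_{W\in\mathfrak S}2^{\mathcal CW}$ be $\kappa$-consistent, and for each $W$ let $b_W$ denote the $\mathcal CW$-coordinate of $\vec b$. Then there exists $x\in\mathcal X$ so that $d_W(b_W,\pi_W(x))\le\theta_e$ for all $W\in\mathfrak S$. Moreover, $x$ is coarsely unique in the sense that the set of all $x\in\mathcal X$ which satisfy $d_W(b_W,\pi_W(x))\le\theta_e$ for every $W\in\mathfrak S$ has diameter at most $\theta_u$.
   Context: Hierarchical spaces. A $q$-quasigeodesic space is a metric space in which any two points are joined by a $(q,q)$-quasigeodesic. A hierarchical space $(\mathcal X,\mathfrak S)$ consists of a $q$-quasigeodesic space $(\mathcal X,d_{\mathcal X})$, an index set $\mathfrak S$ and geodesic metric spaces $(\mathcal CW,d_W)$, $W\in\mathfrak S$ (not required to be hyperbolic), such that (1)–(9) below hold. Conventions: the distance between two sets is the infimum of distances between their points; for $x,y\in\mathcal X$ and $p\subseteq\mathcal CW$, $d_W(x,y)=d_W(\pi_W(x),\pi_W(y))$ and $d_W(x,p)=d_W(\pi_W(x),p)$; $V\sqsubset W$ means $V\sqsubseteq W$ and $V\ne W$. (1) Projections: there are $\xi,K\ge 0$ and maps $\pi_W:\mathcal X\to2^{\mathcal CW}$ ($W\in\mathfrak S$) sending points to nonempty sets of diameter $\le\xi$; each $\pi_W$ is $(K,K)$-coarsely Lipschitz and $\pi_W(\mathcal X)$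 is $K$-quasiconvex in $\mathcal CW$. (2) Nesting: $\mathfrak S$ has a partial order $\sqsubseteq$, and either $\mathfrak S=\emptyset$ or there is a unique $\sqsubseteq$-maximal element. Put $\mathfrak S_W=\{V:V\sqsubseteq W\}$. If $V\sqsubset W$ there is a specified subset $\rho^V_W\subset\mathcal CW$ of diameter $\le\xi$ and a map $\rho^W_V:\mathcal CW\to2^{\mathcal CV}$. (3) Orthogonality: $\mathfrak S$ has a symmetric anti-reflexive relation $\perp$. If $V\sqsubseteq W$ and $W\perp U$ then $V\perp U$. For each $T\in\mathfrak S$ and $U\in\mathfrak S_T$ with $\{V\in\mathfrak S_T:V\perp U\}\ne\emptyset$ there is $W\in\mathfrak S_T-\{T\}$ such that $V\sqsubseteq W$ whenever $V\perp U$ and $V\sqsubseteq T$. If $V\perp W$ then $V,W$ are not $\sqsubseteq$-comparable. (4) Transversality and consistency: if $V,W$ are not orthogonal and neither is nested in the other they are transverse, $V\pitchfork W$. There is $\kappa_0\ge0$ such that: if $V\pitchfork W$ there are sets $\rho^V_W\subseteq\mathcal CW$, $\rho^W_V\subseteq\mathcal CV$ of diameter $\le\xi$ with $\min\{d_W(\pi_W(x),\rho^V_W),d_V(\pi_V(x),\rho^W_V)\}\le\kappa_0$ for all $x\in\mathcal X$; if $V\sqsubset W$ then $\min\{d_W(\pi_W(x),\rho^V_W),\mathrm{diam}_{\mathcal CV}(\pi_V(x)\cup\rho^W_V(\pi_W(x)))\}\le\kappa_0$ for all $x$; and if $U\sqsubseteq V$ then $d_W(\rho^U_W,\rho^V_W)\le\kappa_0$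 whenever $V\sqsubset W$, or $V\pitchfork W$ and $W\not\perp U$. (5) Finite complexity: there is $n\ge0$ (the complexity) such that any set of pairwise $\sqsubseteq$-comparable elements has at most $n$ elements. (6) Large links: there are $\lambda\ge1$, $E\ge\max\{\xi,\kappa_0\}$ such that for $W\in\mathfrak S$, $x,x'\in\mathcal X$ and $N=\lambda d_W(x,x')+\lambda$ there is a collection $\{T_i\}\subseteq\mathfrak S_W-\{W\}$ of at most $\lfloor N\rfloor$ elements such that every $T\in\mathfrak S_W-\{W\}$ either lies in some $\mathfrak S_{T_i}$ or satisfies $d_T(x,x')<E$; moreover $d_W(x,\rho^{T_i}_W)\le N$ for all $i$. (7) Bounded geodesic image: there is $E>0$ such that for all $V\sqsubset W$ and all geodesics $\gamma$ of $\mathcal CW$, either $\mathrm{diam}_{\mathcal CV}(\rho^W_V(\gamma))\le E$ or $\gamma$ meets the $E$-neighborhood of $\rho^V_W$. (8) Partial realization: there is $\alpha$ such that for every family $\{V_j\}$ of pairwise orthogonal elements and $p_j\in\pi_{V_j}(\mathcal X)$ there is $x\in\mathcal X$ with $d_{V_j}(x,p_j)\le\alpha$ for all $j$, and $d_V(x,\rho^{V_j}_V)\le\alpha$ whenever $V_j\sqsubset V$ or $V\pitchfork V_j$ for some $j$. (9) Uniqueness: for each $\kappa\ge0$ there is $\theta_u(\kappa)$ such that $d_{\mathcal X}(x,y)\ge\theta_u(\kappa)$ implies $d_V(x,y)\ge\kappa$ for some $V\in\mathfrak S$. (A hierarchically hyperbolic space is a hierarchical space in which the $\mathcal CW$ are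 uniformly hyperbolic.) Consistency. A tuple $\vec b=(b_W)\in\prod_{W\in\mathfrak S}2^{\mathcal CW}$ of (nonempty) sets with $\mathrm{diam}_{\mathcal CW}(b_W)\le\kappa$ for all $W$ is $\kappa$-consistent if: $d_W(b_W,\pi_W(\mathcal X))\le\kappa$ for all $W\in\mathfrak S$ (admissibility); whenever $V\pitchfork W$, $\min\{d_W(b_W,\rho^V_W),d_V(b_V,\rho^W_V)\}\le\kappa$; and whenever $V\sqsubset W$, $\min\{d_W(b_W,\rho^V_W),\mathrm{diam}_{\mathcal CV}(b_V\cup\rho^W_V(b_W))\}\le\kappa$.
   Formalization: The maps ρ^W_V : CW → 2^{CV} (V properly nested in W) are required to take nonempty values, like π_W and b_W; if empty values are allowed, nested consistency and bounded geodesic image become vacuous and the claim fails (e.g. two lines glued at a point with ρ^S_V empty). *)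

theory Defs
  imports "HOL-Analysis.Analysis"
begin

text \<open>
  Distances between sets and diameters take values in the extended nonnegative reals, so that
  the distance to an empty set is infinite and the diameter of an unbounded set is infinite.
\<close>

definition set_dist :: "('a \<Rightarrow> 'a \<Rightarrow> real) \<Rightarrow> 'a set \<Rightarrow> 'a set \<Rightarrow> ennreal" where
  "set_dist d A B = (INF a\<in>A. INF b\<in>B. ennreal (d a b))"

definition set_diam :: "('a \<Rightarrow> 'a \<Rightarrow> real) \<Rightarrow> 'a set \<Rightarrow> ennreal" where
  "set_diam d A = (SUP a\<in>A. SUP b\<in>A. ennreal (d a b))"

definition geodesic_path ::
    "'a set \<Rightarrow> ('a \<Rightarrow> 'a \<Rightarrow> real) \<Rightarrow> real \<Rightarrow> (real \<Rightarrow> 'a) \<Rightarrow> bool" where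
  "geodesic_path M d L g \<longleftrightarrow>
     0 \<le> L \<and> g \<in> {0..L} \<rightarrow> M \<and> (\<forall>s\<in>{0..L}. \<forall>t\<in>{0..L}. d (g s) (g t) = \<bar>s - t\<bar>)"

definition geodesic_metric_space :: "'a set \<Rightarrow> ('a \<Rightarrow> 'a \<Rightarrow> real) \<Rightarrow> bool" where
  "geodesic_metric_space M d \<longleftrightarrow>
     Metric_space M d \<and>
     (\<forall>x\<in>M. \<forall>y\<in>M. \<exists>L g. geodesic_path M d L g \<and> g 0 = x \<and> g L = y)"

definition quasigeodesic_path ::
    "real \<Rightarrow> real \<Rightarrow> 'a set \<Rightarrow> ('a \<Rightarrow> 'a \<Rightarrow> real) \<Rightarrow> real \<Rightarrow> (real \<Rightarrow> 'a) \<Rightarrow> bool" where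
  "quasigeodesic_path k c M d L g \<longleftrightarrow>
     0 \<le> L \<and> g \<in> {0..L} \<rightarrow> M \<and>
     (\<forall>s\<in>{0..L}. \<forall>t\<in>{0..L}.
        \<bar>s - t\<bar> / k - c \<le> d (g s) (g t) \<and> d (g s) (g t) \<le> k * \<bar>s - t\<bar> + c)"

definition quasigeodesic_metric_space :: "real \<Rightarrow> 'a set \<Rightarrow> ('a \<Rightarrow> 'a \<Rightarrow> real) \<Rightarrow> bool" where
  "quasigeodesic_metric_space q M d \<longleftrightarrow>
     1 \<le> q \<and> Metric_space M d \<and>
     (\<forall>x\<in>M. \<forall>y\<in>M. \<exists>L g. quasigeodesic_path q q M d L g \<and> g 0 = x \<and> g L = y)"

definition quasiconvex_in :: "real \<Rightarrow> 'a set \<Rightarrow> ('a \<Rightarrow> 'a \<Rightarrow> real) \<Rightarrow> 'a set \<Rightarrow> bool" where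
  "quasiconvex_in K M d A \<longleftrightarrow>
     A \<subseteq> M \<and>
     (\<forall>L g. geodesic_path M d L g \<longrightarrow> g 0 \<in> A \<longrightarrow> g L \<in> A \<longrightarrow>
        (\<forall>t\<in>{0..L}. set_dist d {g t} A \<le> ennreal K))"

text \<open>
  The spaces \<open>CW\<close> are the carriers \<open>cspace H W\<close> inside one type; they may be unrelated for
  different \<open>W\<close>, each with its own metric \<open>cdist H W\<close>.
  The superscript of \<open>\<rho>\<close> is the first index: \<open>rho_set H V W\<close> is the subset \<open>\<rho>\<^sup>V\<^sub>W\<close>
  of \<open>CW\<close> (for \<open>V\<close> properly nested in or transverse to \<open>W\<close>), and \<open>rho_map H W V\<close> is the map
  \<open>\<rho>\<^sup>W\<^sub>V\<close> from \<open>CW\<close> to subsets of \<open>CV\<close> (for \<open>V\<close> properly nested in \<open>W\<close>).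
  All components are only meaningful on \<open>points H\<close>, \<open>index H\<close> and the \<open>cspace H W\<close>.
\<close>

record ('x, 's, 'c) hierarchy =
  points :: "'x set"
  pdist :: "'x \<Rightarrow> 'x \<Rightarrow> real"
  index :: "'s set"
  cspace :: "'s \<Rightarrow> 'c set"
  cdist :: "'s \<Rightarrow> 'c \<Rightarrow> 'c \<Rightarrow> real"
  proj :: "'s \<Rightarrow> 'x \<Rightarrow> 'c set"
  nested :: "'s \<Rightarrow> 's \<Rightarrow> bool"
  orth :: "'s \<Rightarrow> 's \<Rightarrow> bool"
  rho_set :: "'s \<Rightarrow> 's \<Rightarrow> 'c set"
  rho_map :: "'s \<Rightarrow> 's \<Rightarrow> 'c \<Rightarrow> 'c set"

definition psnested :: "('x, 's, 'c) hierarchy \<Rightarrow> 's \<Rightarrow> 's \<Rightarrow> bool" where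
  "psnested H V W \<longleftrightarrow> nested H V W \<and> V \<noteq> W"

definition transverse :: "('x, 's, 'c) hierarchy \<Rightarrow> 's \<Rightarrow> 's \<Rightarrow> bool" where
  "transverse H V W \<longleftrightarrow> \<not> orth H V W \<and> \<not> nested H V W \<and> \<not> nested H W V"

definition below :: "('x, 's, 'c) hierarchy \<Rightarrow> 's \<Rightarrow> 's set" where
  "below H W = {V \<in> index H. nested H V W}"

definition cset_dist :: "('x, 's, 'c) hierarchy \<Rightarrow> 's \<Rightarrow> 'c set \<Rightarrow> 'c set \<Rightarrow> ennreal" where
  "cset_dist H W = set_dist (cdist H W)"

definition cset_diam :: "('x, 's, 'c) hierarchy \<Rightarrow> 's \<Rightarrow> 'c set \<Rightarrow> ennreal" where
  "cset_diam H W = set_diam (cdist H W)"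

definition proj_dist :: "('x, 's, 'c) hierarchy \<Rightarrow> 's \<Rightarrow> 'x \<Rightarrow> 'x \<Rightarrow> ennreal" where
  "proj_dist H W x y = cset_dist H W (proj H W x) (proj H W y)"

definition proj_image :: "('x, 's, 'c) hierarchy \<Rightarrow> 's \<Rightarrow> 'c set" where
  "proj_image H W = (\<Union>x\<in>points H. proj H W x)"

definition rho_image :: "('x, 's, 'c) hierarchy \<Rightarrow> 's \<Rightarrow> 's \<Rightarrow> 'c set \<Rightarrow> 'c set" where
  "rho_image H W V A = (\<Union>p\<in>A. rho_map H W V p)"

definition hs_projections :: "('x, 's, 'c) hierarchy \<Rightarrow> real \<Rightarrow> real \<Rightarrow> bool" where
  "hs_projections H \<xi> K \<longleftrightarrow>
     (\<forall>W\<in>index H.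
        (\<forall>x\<in>points H. proj H W x \<subseteq> cspace H W \<and> proj H W x \<noteq> {} \<and>
           cset_diam H W (proj H W x) \<le> ennreal \<xi>) \<and>
        (\<forall>x\<in>points H. \<forall>y\<in>points H. proj_dist H W x y \<le> ennreal (K * pdist H x y + K)) \<and>
        quasiconvex_in K (cspace H W) (cdist H W) (proj_image H W))"

text \<open>
  The maps \<open>\<rho>\<^sup>W\<^sub>V\<close>, like the projections, are coarse maps: their values are nonempty.
  Nonemptiness of the sets \<open>\<rho>\<^sup>V\<^sub>W\<close> follows from partial realization, since the distance to an
  empty set is infinite.
\<close>

definition hs_nesting :: "('x, 's, 'c) hierarchy \<Rightarrow> real \<Rightarrow> bool" where
  "hs_nesting H \<xi> \<longleftrightarrow>
     reflp_on (index H) (nested H) \<and> antisymp_on (index H) (nested H) \<and>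
     transp_on (index H) (nested H) \<and>
     (index H = {} \<or> (\<exists>!M. M \<in> index H \<and> (\<forall>V\<in>index H. nested H M V \<longrightarrow> V = M))) \<and>
     (\<forall>V\<in>index H. \<forall>W\<in>index H. psnested H V W \<longrightarrow>
        rho_set H V W \<subseteq> cspace H W \<and> cset_diam H W (rho_set H V W) \<le> ennreal \<xi> \<and>
        (\<forall>p\<in>cspace H W. rho_map H W V p \<subseteq> cspace H V \<and> rho_map H W V p \<noteq> {}))"

definition hs_orthogonality :: "('x, 's, 'c) hierarchy \<Rightarrow> bool" where
  "hs_orthogonality H \<longleftrightarrow>
     symp_on (index H) (orth H) \<and> irreflp_on (index H) (orth H) \<and>
     (\<forall>V\<in>index H. \<forall>W\<in>index H. \<forall>U\<in>index H. nested H V W \<longrightarrow> orth H W U \<longrightarrow> orth H V U) \<and>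
     (\<forall>T\<in>index H. \<forall>U\<in>below H T. {V \<in> below H T. orth H V U} \<noteq> {} \<longrightarrow>
        (\<exists>W\<in>below H T - {T}. \<forall>V\<in>below H T. orth H V U \<longrightarrow> nested H V W)) \<and>
     (\<forall>V\<in>index H. \<forall>W\<in>index H. orth H V W \<longrightarrow> \<not> nested H V W \<and> \<not> nested H W V)"

definition hs_consistency :: "('x, 's, 'c) hierarchy \<Rightarrow> real \<Rightarrow> real \<Rightarrow> bool" where
  "hs_consistency H \<xi> \<kappa>\<^sub>0 \<longleftrightarrow>
     (\<forall>V\<in>index H. \<forall>W\<in>index H. transverse H V W \<longrightarrow>
        rho_set H V W \<subseteq> cspace H W \<and> cset_diam H W (rho_set H V W) \<le> ennreal \<xi> \<and>
        rho_set H W V \<subseteq> cspace H V \<and> cset_diam H V (rho_set H W V) \<le> ennreal \<xi> \<and>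
        (\<forall>x\<in>points H.
           min (cset_dist H W (proj H W x) (rho_set H V W))
               (cset_dist H V (proj H V x) (rho_set H W V)) \<le> ennreal \<kappa>\<^sub>0)) \<and>
     (\<forall>V\<in>index H. \<forall>W\<in>index H. psnested H V W \<longrightarrow>
        (\<forall>x\<in>points H.
           min (cset_dist H W (proj H W x) (rho_set H V W))
               (cset_diam H V (proj H V x \<union> rho_image H W V (proj H W x))) \<le> ennreal \<kappa>\<^sub>0)) \<and>
     (\<forall>U\<in>index H. \<forall>V\<in>index H. \<forall>W\<in>index H.
        nested H U V \<longrightarrow> psnested H V W \<or> (transverse H V W \<and> \<not> orth H W U) \<longrightarrow>
        cset_dist H W (rho_set H U W) (rho_set H V W) \<le> ennreal \<kappa>\<^sub>0)"

definition hs_finite_complexity :: "('x, 's, 'c) hierarchy \<Rightarrow> bool" where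
  "hs_finite_complexity H \<longleftrightarrow>
     (\<exists>n::nat. \<forall>A\<subseteq>index H. (\<forall>V\<in>A. \<forall>W\<in>A. nested H V W \<or> nested H W V) \<longrightarrow>
        finite A \<and> card A \<le> n)"

text \<open>
  The distance \<open>proj_dist H W x x'\<close> is finite because projections of points are nonempty, so
  converting it to a real number below loses nothing.
\<close>

definition hs_large_links :: "('x, 's, 'c) hierarchy \<Rightarrow> real \<Rightarrow> real \<Rightarrow> bool" where
  "hs_large_links H \<xi> \<kappa>\<^sub>0 \<longleftrightarrow>
     (\<exists>\<Lambda> E::real. \<Lambda> \<ge> 1 \<and> E \<ge> max \<xi> \<kappa>\<^sub>0 \<and>
        (\<forall>W\<in>index H. \<forall>x\<in>points H. \<forall>x'\<in>points H.
           let N = \<Lambda> * enn2real (proj_dist H W x x') + \<Lambda> in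
           \<exists>\<T>. \<T> \<subseteq> below H W - {W} \<and> finite \<T> \<and> int (card \<T>) \<le> \<lfloor>N\<rfloor> \<and>
             (\<forall>T\<in>below H W - {W}.
                (\<exists>T'\<in>\<T>. T \<in> below H T') \<or> proj_dist H T x x' < ennreal E) \<and>
             (\<forall>T'\<in>\<T>. cset_dist H W (proj H W x) (rho_set H T' W) \<le> ennreal N)))"

definition hs_bounded_geodesic_image :: "('x, 's, 'c) hierarchy \<Rightarrow> bool" where
  "hs_bounded_geodesic_image H \<longleftrightarrow>
     (\<exists>E>0. \<forall>V\<in>index H. \<forall>W\<in>index H. psnested H V W \<longrightarrow>
        (\<forall>L g. geodesic_path (cspace H W) (cdist H W) L g \<longrightarrow>
           cset_diam H V (rho_image H W V (g ` {0..L})) \<le> ennreal E \<or>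
           (\<exists>t\<in>{0..L}. cset_dist H W {g t} (rho_set H V W) \<le> ennreal E)))"

text \<open>
  A family of pairwise orthogonal elements has no repetitions, so it is given as a set \<open>F\<close>.
  The empty family is allowed; in particular \<open>points H\<close> is nonempty.
\<close>

definition hs_partial_realization :: "('x, 's, 'c) hierarchy \<Rightarrow> bool" where
  "hs_partial_realization H \<longleftrightarrow>
     (\<exists>\<alpha>\<ge>0. \<forall>F\<subseteq>index H. \<forall>p.
        (\<forall>V\<in>F. \<forall>W\<in>F. V \<noteq> W \<longrightarrow> orth H V W) \<longrightarrow> (\<forall>V\<in>F. p V \<in> proj_image H V) \<longrightarrow>
        (\<exists>x\<in>points H.
           (\<forall>V\<in>F. cset_dist H V (proj H V x) {p V} \<le> ennreal \<alpha>) \<and>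
           (\<forall>V\<in>F. \<forall>W\<in>index H. psnested H V W \<or> transverse H W V \<longrightarrow>
              cset_dist H W (proj H W x) (rho_set H V W) \<le> ennreal \<alpha>)))"

definition hs_uniqueness :: "('x, 's, 'c) hierarchy \<Rightarrow> bool" where
  "hs_uniqueness H \<longleftrightarrow>
     (\<forall>\<kappa>\<ge>0. \<exists>\<theta>::real. \<forall>x\<in>points H. \<forall>y\<in>points H.
        pdist H x y \<ge> \<theta> \<longrightarrow> (\<exists>V\<in>index H. proj_dist H V x y \<ge> ennreal \<kappa>))"

definition hierarchical_space :: "real \<Rightarrow> ('x, 's, 'c) hierarchy \<Rightarrow> bool" where
  "hierarchical_space q H \<longleftrightarrow>
     quasigeodesic_metric_space q (points H) (pdist H) \<and>
     (\<forall>W\<in>index H. geodesic_metric_space (cspace H W) (cdist H W)) \<and>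
     (\<exists>\<xi>\<ge>0. \<exists>K\<ge>0. \<exists>\<kappa>\<^sub>0\<ge>0.
        hs_projections H \<xi> K \<and> hs_nesting H \<xi> \<and> hs_orthogonality H \<and>
        hs_consistency H \<xi> \<kappa>\<^sub>0 \<and> hs_finite_complexity H \<and> hs_large_links H \<xi> \<kappa>\<^sub>0 \<and>
        hs_bounded_geodesic_image H \<and> hs_partial_realization H \<and> hs_uniqueness H)"

definition consistent_tuple :: "('x, 's, 'c) hierarchy \<Rightarrow> real \<Rightarrow> ('s \<Rightarrow> 'c set) \<Rightarrow> bool" where
  "consistent_tuple H \<kappa> b \<longleftrightarrow>
     (\<forall>W\<in>index H. b W \<subseteq> cspace H W \<and> b W \<noteq> {} \<and> cset_diam H W (b W) \<le> ennreal \<kappa> \<and>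
        cset_dist H W (b W) (proj_image H W) \<le> ennreal \<kappa>) \<and>
     (\<forall>V\<in>index H. \<forall>W\<in>index H. transverse H V W \<longrightarrow>
        min (cset_dist H W (b W) (rho_set H V W))
            (cset_dist H V (b V) (rho_set H W V)) \<le> ennreal \<kappa>) \<and>
     (\<forall>V\<in>index H. \<forall>W\<in>index H. psnested H V W \<longrightarrow>
        min (cset_dist H W (b W) (rho_set H V W))
            (cset_diam H V (b V \<union> rho_image H W V (b W))) \<le> ennreal \<kappa>)"

end

theory Submission
  imports Defs
begin

text \<open>
  The tuple is realized by partial realization points of a pairwise orthogonal family \<open>F\<close> below an
  index \<open>V\<close>; for \<open>V\<close> the largest index this is the theorem. The family is built by induction on the
  level of \<open>V\<close>, keeping the realization points close to the tuple in every coordinate that is not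
  orthogonal to \<open>F\<close>. If some coordinate \<open>W\<close>, necessarily orthogonal to \<open>F\<close>, is still bad, one adds
  to \<open>F\<close> the family that the induction provides for \<open>W\<close>. When this destroys the invariant, the
  coordinate witnessing it is also bad, and it properly contains \<open>W\<close> or follows \<open>W\<close> in the partial
  order that consistency puts on transverse bad coordinates. For nesting-maximal bad coordinates
  this would go on forever, whereas large links forbids long chains in that order.
\<close>

text \<open>So the family itself has to grow until what remains orthogonal to it is harmless.
  Badness travels between coordinates through a statement that mentions no point of the space:
  \<open>be T\<close> is far from \<open>ro W T\<close>. If a point is bad in \<open>W\<close> and
  this holds, then it is also bad in \<open>T\<close>, by bounded geodesic image when
  \<open>W\<close> is nested in \<open>T\<close> and by transverse consistency when they are
  transverse. In this way realization points of other families give information about one fixed bad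
  point \<open>x\<close>. The final constant must not depend on the tuple. Each extension computes
  its constant from the previous ones, and the number of extensions is limited because the
  coordinates orthogonal to the family lie below an index of ever smaller level. The bound
  \<open>g\<close> serves only to refute infinite chains and never enters the constant.\<close>

text \<open>
  Sets of bounded diameter are replaced by one of their points: \<open>pr W x\<close> is in the projection of
  \<open>x\<close>, \<open>ro V W\<close> in \<open>\<rho>\<^sup>V\<^sub>W\<close>, and \<open>Be\<close> consists of the selections of points from the consistent tuples.
  All constants except the bound \<open>g\<close> of large links are absorbed in \<open>M\<close>. The assumption
  \<open>nested_link\<close> is what remains of bounded geodesic image together with the nested consistency of
  points and tuples, for a geodesic from \<open>be W\<close> to \<open>pr W x\<close>.
\<close>

locale coarse_hierarchy =
  fixes X :: "'x set" and I :: "'s set"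
    and le orth :: "'s \<Rightarrow> 's \<Rightarrow> bool"
    and d :: "'s \<Rightarrow> 'c \<Rightarrow> 'c \<Rightarrow> real"
    and pr :: "'s \<Rightarrow> 'x \<Rightarrow> 'c" and ro :: "'s \<Rightarrow> 's \<Rightarrow> 'c"
    and Be :: "('s \<Rightarrow> 'c) set"
    and M :: real and g :: "real \<Rightarrow> nat" and lev :: "'s \<Rightarrow> nat" and n :: nat
  assumes d_sym: "d W p q = d W q p"
    and d_tri: "d W p r \<le> d W p q + d W q r"
    and M1: "M \<ge> 1"
    and le_refl: "V \<in> I \<Longrightarrow> le V V"
    and le_antisym: "V \<in> I \<Longrightarrow> W \<in> I \<Longrightarrow> le V W \<Longrightarrow> le W V \<Longrightarrow> V = W"
    and le_trans: "U \<in> I \<Longrightarrow> V \<in> I \<Longrightarrow> W \<in> I \<Longrightarrow> le U V \<Longrightarrow> le V W \<Longrightarrow> le U W"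
    and orth_sym: "V \<in> I \<Longrightarrow> W \<in> I \<Longrightarrow> orth V W \<Longrightarrow> orth W V"
    and orth_down: "V \<in> I \<Longrightarrow> W \<in> I \<Longrightarrow> U \<in> I \<Longrightarrow> le V W \<Longrightarrow> orth W U \<Longrightarrow> orth V U"
    and orth_not_le: "V \<in> I \<Longrightarrow> W \<in> I \<Longrightarrow> orth V W \<Longrightarrow> \<not> le V W"
    and orth_container: "T \<in> I \<Longrightarrow> U \<in> I \<Longrightarrow> le U T \<Longrightarrow> V \<in> I \<Longrightarrow> le V T \<Longrightarrow> orth V U \<Longrightarrow>
      \<exists>W\<in>I. le W T \<and> W \<noteq> T \<and> (\<forall>V\<in>I. le V T \<longrightarrow> orth V U \<longrightarrow> le V W)"
    and lev_less: "V \<in> I \<Longrightarrow> W \<in> I \<Longrightarrow> le V W \<Longrightarrow> V \<noteq> W \<Longrightarrow> lev V < lev W"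
    and lev_le: "W \<in> I \<Longrightarrow> lev W \<le> n"
    and transverse_point:
      "x \<in> X \<Longrightarrow> V \<in> I \<Longrightarrow> W \<in> I \<Longrightarrow> \<not> orth V W \<Longrightarrow> \<not> le V W \<Longrightarrow> \<not> le W V \<Longrightarrow>
        d W (pr W x) (ro V W) \<le> M \<or> d V (pr V x) (ro W V) \<le> M"
    and transverse_tuple:
      "be \<in> Be \<Longrightarrow> V \<in> I \<Longrightarrow> W \<in> I \<Longrightarrow> \<not> orth V W \<Longrightarrow> \<not> le V W \<Longrightarrow> \<not> le W V \<Longrightarrow>
        d W (be W) (ro V W) \<le> M \<or> d V (be V) (ro W V) \<le> M"
    and nested_link:
      "x \<in> X \<Longrightarrow> be \<in> Be \<Longrightarrow> V \<in> I \<Longrightarrow> W \<in> I \<Longrightarrow> le V W \<Longrightarrow> V \<noteq> W \<Longrightarrow>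
        d V (pr V x) (be V) \<le> M \<or> d W (be W) (ro V W) \<le> d W (be W) (pr W x) + M"
    and ro_nested:
      "U \<in> I \<Longrightarrow> V \<in> I \<Longrightarrow> W \<in> I \<Longrightarrow> le U V \<Longrightarrow> le V W \<Longrightarrow> V \<noteq> W \<Longrightarrow>
        d W (ro U W) (ro V W) \<le> M"
    and ro_transverse:
      "U \<in> I \<Longrightarrow> V \<in> I \<Longrightarrow> W \<in> I \<Longrightarrow> le U V \<Longrightarrow>
        \<not> orth V W \<Longrightarrow> \<not> le V W \<Longrightarrow> \<not> le W V \<Longrightarrow> \<not> orth W U \<Longrightarrow> d W (ro U W) (ro V W) \<le> M"
    and realization:
      "be \<in> Be \<Longrightarrow> F \<subseteq> I \<Longrightarrow> pairwise orth F \<Longrightarrow>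
        \<exists>x\<in>X. (\<forall>V\<in>F. d V (pr V x) (be V) \<le> M) \<and>
          (\<forall>V\<in>F. \<forall>W\<in>I. \<not> orth V W \<longrightarrow> \<not> le W V \<longrightarrow> d W (pr W x) (ro V W) \<le> M)"
    and large_links:
      "W \<in> I \<Longrightarrow> x \<in> X \<Longrightarrow> y \<in> X \<Longrightarrow> d W (pr W x) (pr W y) \<le> R \<Longrightarrow>
        \<exists>\<T>\<subseteq>I. finite \<T> \<and> card \<T> \<le> g R \<and> (\<forall>T'\<in>\<T>. le T' W \<and> T' \<noteq> W) \<and>
          (\<forall>T\<in>I. le T W \<longrightarrow> T \<noteq> W \<longrightarrow> M < d T (pr T x) (pr T y) \<longrightarrow> (\<exists>T'\<in>\<T>. le T T'))"
begin

section \<open>Orthogonal families and their realization points\<close>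

definition tv :: "'s \<Rightarrow> 's \<Rightarrow> bool" where
  "tv V W \<longleftrightarrow> \<not> orth V W \<and> \<not> le V W \<and> \<not> le W V"

definition rz :: "('s \<Rightarrow> 'c) \<Rightarrow> 's set \<Rightarrow> 'x \<Rightarrow> bool" where
  "rz be F x \<longleftrightarrow> x \<in> X \<and> (\<forall>V\<in>F. d V (pr V x) (be V) \<le> M) \<and>
     (\<forall>V\<in>F. \<forall>W\<in>I. \<not> orth V W \<longrightarrow> \<not> le W V \<longrightarrow> d W (pr W x) (ro V W) \<le> M)"

definition ofam :: "'s \<Rightarrow> 's set \<Rightarrow> bool" where
  "ofam V F \<longleftrightarrow> F \<subseteq> I \<and> pairwise orth F \<and> (\<forall>U\<in>F. le U V)"

text \<open>The bound is asked of every realization point, so that by \<open>rz_mono\<close> it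
  persists when the family is enlarged.\<close>

definition good :: "('s \<Rightarrow> 'c) \<Rightarrow> 's \<Rightarrow> 's set \<Rightarrow> real \<Rightarrow> bool" where
  "good be V F C \<longleftrightarrow> (\<forall>x. rz be F x \<longrightarrow> (\<forall>T\<in>I. le T V \<longrightarrow> d T (pr T x) (be T) \<le> C))"

definition gengood :: "('s \<Rightarrow> 'c) \<Rightarrow> 's \<Rightarrow> 's set \<Rightarrow> real \<Rightarrow> bool" where
  "gengood be V F C \<longleftrightarrow> (\<forall>x. rz be F x \<longrightarrow>
     (\<forall>T\<in>I. le T V \<longrightarrow> (\<exists>U\<in>F. \<not> orth T U) \<longrightarrow> d T (pr T x) (be T) \<le> C))"

text \<open>Excluding \<open>V\<close> itself keeps the induction on levels applicable when
  \<open>F\<close> is empty.\<close>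

definition perp :: "'s \<Rightarrow> 's set \<Rightarrow> 's set" where
  "perp V F = {T \<in> I. le T V \<and> T \<noteq> V \<and> (\<forall>U\<in>F. orth T U)}"

lemma rz_ex: "be \<in> Be \<Longrightarrow> ofam V F \<Longrightarrow> \<exists>x. rz be F x"
  using realization[of be F] unfolding rz_def ofam_def by blast

lemma rz_mono: "rz be F x \<Longrightarrow> G \<subseteq> F \<Longrightarrow> rz be G x"
  unfolding rz_def by blast

lemma rz_X: "rz be F x \<Longrightarrow> x \<in> X"
  unfolding rz_def by blast

lemma good_mono: "good be V F C \<Longrightarrow> C \<le> C' \<Longrightarrow> good be V F C'"
  unfolding good_def by force

lemma tv_sym: "V \<in> I \<Longrightarrow> W \<in> I \<Longrightarrow> tv V W \<longleftrightarrow> tv W V"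
  unfolding tv_def using orth_sym by blast

lemma ofam_Un:
  assumes "ofam V F" "W \<in> perp V F" "V \<in> I" "ofam W G"
  shows "ofam V (F \<union> G)"
proof -
  have W: "W \<in> I" "le W V" "\<forall>U\<in>F. orth W U" using assms(2) unfolding perp_def by auto
  have ab: "orth b a \<and> orth a b" if "a \<in> F" "b \<in> G" for a b
  proof -
    have I: "a \<in> I" "b \<in> I" "le b W" "orth W a"
      using that W assms(1,4) unfolding ofam_def by auto
    then have "orth b a" using orth_down[of b W a] W(1) by simp
    then show ?thesis using orth_sym[of b a] I by simp
  qed
  have "le b V" if "b \<in> G" for b
    using that le_trans[of b W V] W(1,2) assms(3,4) unfolding ofam_def by auto
  moreover have "pairwise orth (F \<union> G)"
  proof (rule pairwiseI)
    fix a b assume "a \<in> F \<union> G" "b \<in> F \<union> G" "a \<noteq> b"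
    then show "orth a b"
      using ab assms(1,4) unfolding ofam_def by (auto dest: pairwiseD)
  qed
  ultimately show ?thesis using assms(1,4) unfolding ofam_def by auto
qed

section \<open>Passing up\<close>

text \<open>If \<open>x\<close> and \<open>y\<close> are far apart in \<open>V\<close>, then
  \<open>V\<close> is the required coordinate. Otherwise large links covers the elements of \<S>
  other than \<open>V\<close> by at most \<open>g C\<close> indices properly below \<open>V\<close>;
  by pigeonhole one of them contains many elements of \<S>, and the induction on the level goes on
  there.\<close>

lemma passing_up:
  "\<exists>N. \<forall>V\<in>I. \<forall>x\<in>X. \<forall>y\<in>X. \<forall>\<S>. lev V < m \<longrightarrow> finite \<S> \<longrightarrow> \<S> \<subseteq> I \<longrightarrow> N \<le> card \<S> \<longrightarrow>
     (\<forall>S\<in>\<S>. le S V \<and> M < d S (pr S x) (pr S y)) \<longrightarrow>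
     (\<exists>T\<in>I. le T V \<and> (\<exists>S\<in>\<S>. le S T \<and> S \<noteq> T) \<and> C < d T (pr T x) (pr T y))"
proof (induction m)
  case 0
  then show ?case by simp
next
  case (Suc m)
  then obtain N where N: "\<And>V x y \<S>. V \<in> I \<Longrightarrow> x \<in> X \<Longrightarrow> y \<in> X \<Longrightarrow> lev V < m \<Longrightarrow> finite \<S> \<Longrightarrow>
      \<S> \<subseteq> I \<Longrightarrow> N \<le> card \<S> \<Longrightarrow> (\<forall>S\<in>\<S>. le S V \<and> M < d S (pr S x) (pr S y)) \<Longrightarrow>
     (\<exists>T\<in>I. le T V \<and> (\<exists>S\<in>\<S>. le S T \<and> S \<noteq> T) \<and> C < d T (pr T x) (pr T y))"
    by blast
  show ?case
  \<comment> \<open>One of the two extra elements may be \<open>V\<close> itself, the other makes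
    the pigeonhole count strict. Having at least two also provides an element different from
    \<open>V\<close> when \<open>V\<close> is the answer.\<close>
  proof (intro exI[of _ "2 + g C * N"] ballI allI impI)
    fix V x y \<S>
    assume V: "V \<in> I" and x: "x \<in> X" and y: "y \<in> X" and lv: "lev V < Suc m"
      and fin: "finite \<S>" and SI: "\<S> \<subseteq> I" and card: "2 + g C * N \<le> card \<S>"
      and S: "\<forall>S\<in>\<S>. le S V \<and> M < d S (pr S x) (pr S y)"
    show "\<exists>T\<in>I. le T V \<and> (\<exists>S\<in>\<S>. le S T \<and> S \<noteq> T) \<and> C < d T (pr T x) (pr T y)"
    proof (cases "d V (pr V x) (pr V y) \<le> C")
      case False
      have "\<not> \<S> \<subseteq> {V}" using card card_mono[of "{V}" \<S>] by auto
      then obtain S0 where "S0 \<in> \<S>" "S0 \<noteq> V" by blast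
      then show ?thesis using False V S le_refl by fastforce
    next
      case True
      obtain \<T> where T: "\<T> \<subseteq> I" "finite \<T>" "card \<T> \<le> g C"
        "\<forall>T'\<in>\<T>. le T' V \<and> T' \<noteq> V"
        "\<forall>T\<in>I. le T V \<longrightarrow> T \<noteq> V \<longrightarrow> M < d T (pr T x) (pr T y) \<longrightarrow> (\<exists>T'\<in>\<T>. le T T')"
        using large_links[OF V x y True] by blast
      have sub: "\<S> - {V} \<subseteq> (\<Union>T'\<in>\<T>. {S \<in> \<S>. le S T'})" using T(5) S SI by blast
      have "\<exists>T'\<in>\<T>. N \<le> card {S \<in> \<S>. le S T'}"
      proof (rule ccontr)
        assume "\<not> ?thesis"
        then have *: "card {S \<in> \<S>. le S T'} \<le> N" if "T' \<in> \<T>" for T' using that by fastforce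
        have "card (\<S> - {V}) \<le> card (\<Union>T'\<in>\<T>. {S \<in> \<S>. le S T'})"
          using sub fin T(2) by (intro card_mono) auto
        also have "\<dots> \<le> (\<Sum>T'\<in>\<T>. card {S \<in> \<S>. le S T'})" by (rule card_UN_le[OF T(2)])
        also have "\<dots> \<le> card \<T> * N" using sum_bounded_above[OF *] by simp
        also have "\<dots> \<le> g C * N" using T(3) by simp
        finally show False using card card_Diff1_le[of \<S> V] fin
          by (cases "V \<in> \<S>") (simp_all add: card_Diff_singleton)
      qed
      then obtain T' where T': "T' \<in> \<T>" "N \<le> card {S \<in> \<S>. le S T'}" by blast
      have "T' \<in> I" "le T' V" "T' \<noteq> V" using T(1,4) T'(1) by blast+
      moreover from this have "lev T' < m" using lv lev_less[of T' V] V by simp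
      ultimately have "T' \<in> I" "le T' V" "lev T' < m" by simp_all
      moreover have "\<exists>T0\<in>I. le T0 T' \<and> (\<exists>S\<in>{S \<in> \<S>. le S T'}. le S T0 \<and> S \<noteq> T0) \<and>
          C < d T0 (pr T0 x) (pr T0 y)"
        by (rule N) (use \<open>T' \<in> I\<close> \<open>lev T' < m\<close> x y fin SI S T'(2) in auto)
      ultimately obtain T0 where "T0 \<in> I" "le T0 T'" "\<exists>S\<in>{S \<in> \<S>. le S T'}. le S T0 \<and> S \<noteq> T0"
        "C < d T0 (pr T0 x) (pr T0 y)"
        by blast
      then show ?thesis using le_trans[of T0 T' V] \<open>T' \<in> I\<close> \<open>le T' V\<close> V by blast
    qed
  qed
qed

section \<open>The order on transverse bad coordinates\<close>

text \<open>The time order of relevant domains on the way from a point to the tuple: seen in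
  \<open>W\<close>, the tuple is already at \<open>T\<close>, while by \<open>prec_point\<close> a
  point that is bad in \<open>W\<close> is, seen in \<open>T\<close>, still at \<open>W\<close>. The
  definition refers to the tuple only, so the point may change.\<close>

definition prec :: "('s \<Rightarrow> 'c) \<Rightarrow> 's \<Rightarrow> 's \<Rightarrow> bool" where
  "prec be W T \<longleftrightarrow> tv W T \<and> d W (be W) (ro T W) \<le> M"

lemma prec_point:
  assumes "x \<in> X" "V \<in> I" "W \<in> I" "prec be V W" "d V (pr V x) (be V) > 2 * M"
  shows "d W (pr W x) (ro V W) \<le> M"
proof -
  have "d V (pr V x) (be V) \<le> d V (pr V x) (ro W V) + d V (ro W V) (be V)" by (rule d_tri)
  moreover have "d V (ro W V) (be V) \<le> M"
    using assms(4) d_sym[of V "ro W V"] unfolding prec_def by simp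
  ultimately have "\<not> d V (pr V x) (ro W V) \<le> M" using assms(5) by linarith
  then show ?thesis
    using transverse_point[OF assms(1-3)] assms(4) unfolding prec_def tv_def by blast
qed

lemma precI:
  assumes "be \<in> Be" "V \<in> I" "W \<in> I" "tv V W" "d W (be W) (ro V W) > M"
  shows "prec be V W"
  using transverse_tuple[OF assms(1-3)] assms(4,5) unfolding prec_def tv_def by force

lemma precI_point:
  assumes "be \<in> Be" "x \<in> X" "V \<in> I" "W \<in> I" "tv V W"
    and "d V (pr V x) (ro W V) > M" "d W (pr W x) (be W) > 2 * M"
  shows "prec be V W"
proof (rule precI[OF assms(1,3,4,5)])
  have "d W (pr W x) (ro V W) \<le> M"
    using transverse_point[OF assms(2-4)] assms(5,6) unfolding tv_def by force
  then show "d W (be W) (ro V W) > M"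
    using d_tri[of W "pr W x" "be W" "ro V W"] d_sym[of W "be W"] assms(7) by auto
qed

text \<open>In \<open>W2\<close> the point is near \<open>ro W1 W2\<close> and the tuple near
  \<open>ro W3 W2\<close>, so badness of \<open>W2\<close> separates these two. If \<open>W1\<close>
  and \<open>W3\<close> were orthogonal, a point realizing both would be near both; if they were
  nested, the two would be within \<open>M\<close> of each other. Hence \<open>W1\<close> and
  \<open>W3\<close> are transverse, and only the direction remains to be decided.\<close>

lemma prec_trans:
  assumes be: "be \<in> Be" and x: "x \<in> X" and I: "W1 \<in> I" "W2 \<in> I" "W3 \<in> I"
    and p12: "prec be W1 W2" and p23: "prec be W2 W3"
    and b1: "d W1 (pr W1 x) (be W1) > 4 * M" and b2: "d W2 (pr W2 x) (be W2) > 4 * M"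
    and b3: "d W3 (pr W3 x) (be W3) > 4 * M"
  shows "prec be W1 W3"
proof -
  have t: "tv W1 W2" "tv W2 W3" "tv W2 W1" "tv W3 W2"
    using p12 p23 tv_sym I unfolding prec_def by auto
  have "d W2 (pr W2 x) (ro W1 W2) \<le> M" using prec_point[OF x I(1,2) p12] b1 M1 by simp
  moreover have "d W2 (be W2) (ro W3 W2) \<le> M" using p23 unfolding prec_def by simp
  ultimately have far: "d W2 (ro W1 W2) (ro W3 W2) > 2 * M"
    using b2 d_tri[of W2 "pr W2 x" "be W2" "ro W1 W2"]
      d_tri[of W2 "ro W1 W2" "be W2" "ro W3 W2"] d_sym[of W2 "be W2" "ro W3 W2"] by linarith
  have no: "\<not> orth W1 W3"
  proof
    assume "orth W1 W3"
    then have "pairwise orth {W1, W3}" using orth_sym I by (auto simp: pairwise_def)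
    then obtain z where z: "z \<in> X" "\<forall>V\<in>{W1,W3}. \<forall>W\<in>I. \<not> orth V W \<longrightarrow> \<not> le W V \<longrightarrow>
        d W (pr W z) (ro V W) \<le> M"
      using realization[OF be, of "{W1,W3}"] I by auto
    then have "d W2 (pr W2 z) (ro W1 W2) \<le> M" "d W2 (pr W2 z) (ro W3 W2) \<le> M"
      using t I unfolding tv_def by auto
    then show False
      using far d_tri[of W2 "ro W1 W2" "ro W3 W2" "pr W2 z"] d_sym[of W2 "pr W2 z" "ro W1 W2"]
      by linarith
  qed
  have "\<not> le W1 W3"
    using ro_transverse[of W1 W3 W2] I t far M1 unfolding tv_def by auto
  moreover have "\<not> le W3 W1"
    using ro_transverse[of W3 W1 W2] I t far M1 d_sym[of W2 "ro W1 W2"] unfolding tv_def by auto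
  ultimately have t13: "tv W1 W3" using no unfolding tv_def by simp
  \<comment> \<open>A point realizing \<open>W3\<close> alone serves to compare
    \<open>ro W3 W1\<close> with \<open>ro W2 W1\<close>: in \<open>W2\<close> it is far from
    \<open>ro W1 W2\<close>, so consistency places it near \<open>ro W2 W1\<close> in
    \<open>W1\<close>.\<close>
  have "pairwise orth {W3}" by simp
  then obtain z where z: "z \<in> X" "\<forall>V\<in>{W3}. \<forall>W\<in>I. \<not> orth V W \<longrightarrow> \<not> le W V \<longrightarrow>
      d W (pr W z) (ro V W) \<le> M"
    using realization[OF be, of "{W3}"] I by auto
  have z2: "d W2 (pr W2 z) (ro W3 W2) \<le> M" and z1: "d W1 (pr W1 z) (ro W3 W1) \<le> M"
    using z(2) I t t13 tv_sym[of W1 W3] unfolding tv_def by auto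
  have "\<not> d W2 (pr W2 z) (ro W1 W2) \<le> M"
    using far z2 d_tri[of W2 "ro W1 W2" "ro W3 W2" "pr W2 z"] d_sym[of W2 "pr W2 z" "ro W1 W2"]
    by linarith
  then have "d W1 (pr W1 z) (ro W2 W1) \<le> M"
    using transverse_point[OF z(1) I(1,2)] t(1) unfolding tv_def by blast
  moreover have "d W1 (be W1) (ro W2 W1) \<le> M" using p12 unfolding prec_def by simp
  ultimately have "d W1 (be W1) (ro W3 W1) \<le> 3 * M"
    using z1 d_tri[of W1 "be W1" "ro W3 W1" "ro W2 W1"]
      d_tri[of W1 "ro W2 W1" "ro W3 W1" "pr W1 z"] d_sym[of W1 "ro W2 W1" "pr W1 z"]
    by linarith
  \<comment> \<open>The threshold \<open>4 * M\<close> for badness leaves a margin of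
    \<open>M\<close> after the three steps of length \<open>M\<close> from \<open>be W1\<close> to
    \<open>ro W3 W1\<close>.\<close>
  then have "d W1 (pr W1 x) (ro W3 W1) > M"
    using b1 d_tri[of W1 "pr W1 x" "be W1" "ro W3 W1"] d_sym[of W1 "ro W3 W1" "be W1"] by linarith
  then show ?thesis using precI_point[OF be x I(1,3) t13] b3 M1 by simp
qed

section \<open>Passing badness on, and excluding long chains\<close>

text \<open>If \<open>pr W x\<close> were within \<open>D\<close> of \<open>be W\<close>, a geodesic
  between them would be too short to come near \<open>ro V W\<close>, and bounded geodesic image
  would make \<open>x\<close> close to the tuple in \<open>V\<close>.\<close>

lemma nested_far:
  assumes "be \<in> Be" "x \<in> X" "V \<in> I" "W \<in> I" "le V W" "V \<noteq> W"
    and "d V (pr V x) (be V) > M" "d W (be W) (ro V W) > D + M"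
  shows "d W (pr W x) (be W) > D"
  using nested_link[OF assms(2,1,3-6)] assms(7,8) d_sym[of W "be W" "pr W x"] by linarith

text \<open>Consistency of the tuple places \<open>be V\<close> near \<open>ro W V\<close>. As
  \<open>x\<close> is bad in \<open>V\<close>, it is not near \<open>ro W V\<close> there, so
  consistency of \<open>x\<close> places \<open>pr W x\<close> near \<open>ro V W\<close>, which is
  far from \<open>be W\<close>.\<close>

lemma transverse_far:
  assumes "be \<in> Be" "x \<in> X" "V \<in> I" "W \<in> I" "tv V W"
    and "d V (pr V x) (be V) > 2 * M" "d W (be W) (ro V W) > D + M" "D \<ge> 0"
  shows "prec be V W" "d W (pr W x) (be W) > D"
proof -
  show p: "prec be V W" using precI assms by simp
  show "d W (pr W x) (be W) > D"
    using prec_point[OF assms(2-4) p assms(6)] assms(7)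
      d_tri[of W "be W" "ro V W" "pr W x"] d_sym[of W "be W" "pr W x"] by linarith
qed

lemma maximal_above:
  assumes "B \<subseteq> I" "T \<in> B"
  shows "\<exists>S\<in>B. le T S \<and> (\<forall>R\<in>B. le S R \<longrightarrow> R = S)"
  using assms(2)
proof (induction "n - lev T" arbitrary: T rule: less_induct)
  case less
  show ?case
  proof (cases "\<forall>R\<in>B. le T R \<longrightarrow> R = T")
    case True
    then show ?thesis using less.prems assms(1) le_refl by blast
  next
    case False
    then obtain R where R: "R \<in> B" "le T R" "R \<noteq> T" by blast
    have I: "R \<in> I" "T \<in> I" using R less.prems assms(1) by auto
    have "n - lev R < n - lev T" using lev_less[of T R] lev_le[of R] I R by auto
    then obtain S where "S \<in> B" "le R S" "\<forall>Q\<in>B. le S Q \<longrightarrow> Q = S"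
      using less.hyps[of R] R by blast
    then show ?thesis using le_trans[of T R S] I R assms(1) by blast
  qed
qed

lemma prec_irrefl: "V \<in> I \<Longrightarrow> \<not> prec be V V"
  unfolding prec_def tv_def using le_refl by blast

text \<open>
  A realization point \<open>y\<close> of the last element of a \<open>prec\<close>-chain is close to the tuple in all the
  earlier coordinates, in which \<open>x\<close> is far from it. Passing up yields a coordinate properly above
  one in the chain in which \<open>x\<close> and \<open>y\<close> are far apart, hence \<open>x\<close> is far from the tuple, against
  maximality.
\<close>

lemma no_long_chain:
  assumes be: "be \<in> Be" and V: "V \<in> I" and F: "ofam V F"
    and gg: "gengood be V F C" and x: "x \<in> X"
    and xV: "d V (pr V x) (be V) \<le> C"
    and xg: "\<And>T U. T \<in> I \<Longrightarrow> le T V \<Longrightarrow> U \<in> F \<Longrightarrow> \<not> orth T U \<Longrightarrow> d T (pr T x) (be T) \<le> C"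
    and c: "c \<ge> 4 * M" and C: "C \<ge> 0"
    and w: "\<And>i. i \<le> N \<Longrightarrow> w i \<in> perp V F \<and> d (w i) (pr (w i) x) (be (w i)) > c \<and>
        (\<forall>S\<in>perp V F. d S (pr S x) (be S) > c \<longrightarrow> le (w i) S \<longrightarrow> S = w i)"
    and chain: "\<And>i j. i < j \<Longrightarrow> j \<le> N \<Longrightarrow> prec be (w i) (w j)"
    and N: "\<And>\<S> y. y \<in> X \<Longrightarrow> finite \<S> \<Longrightarrow> \<S> \<subseteq> I \<Longrightarrow> N \<le> card \<S> \<Longrightarrow>
     (\<forall>S\<in>\<S>. le S V \<and> M < d S (pr S x) (pr S y)) \<Longrightarrow>
     (\<exists>T\<in>I. le T V \<and> (\<exists>S\<in>\<S>. le S T \<and> S \<noteq> T) \<and> 2 * C + 2 * c + 2 * M < d T (pr T x) (pr T y))"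
  shows False
proof -
  define W where "W = w N"
  have wI: "w i \<in> I \<and> le (w i) V \<and> w i \<noteq> V" if "i \<le> N" for i
    using w[OF that] unfolding perp_def by auto
  have W: "W \<in> I" "le W V" "W \<noteq> V" "W \<in> perp V F" "d W (pr W x) (be W) > c"
    using wI[of N] w[of N] unfolding W_def by auto
  have "ofam W {W}" using W le_refl unfolding ofam_def by simp
  then have "ofam V (F \<union> {W})" by (rule ofam_Un[OF F W(4) V])
  \<comment> \<open>Keeping \<open>F\<close> in the family makes the invariant \<open>gg\<close>
    available for \<open>y\<close>; adding \<open>W\<close> places \<open>y\<close> near
    \<open>ro W T\<close> in each coordinate \<open>T\<close> that is neither orthogonal to
    \<open>W\<close> nor below it.\<close>
  then obtain y where y: "rz be (F \<union> {W}) y" using rz_ex[OF be] by blast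
  then have yX: "y \<in> X" and yF: "rz be F y" using rz_X rz_mono by blast+
  have yW: "d T (pr T y) (ro W T) \<le> M" if "T \<in> I" "\<not> orth W T" "\<not> le T W" for T
    using y that unfolding rz_def by blast
  have inj: "inj_on w {..<N}"
  proof (rule linorder_inj_onI)
    fix i j assume "i < j" "i \<in> {..<N}" "j \<in> {..<N}"
    then show "w i \<noteq> w j" using chain[of i j] prec_irrefl[of "w i"] wI[of i] by fastforce
  qed auto
  have tvW: "tv (w i) W" "d (w i) (be (w i)) (ro W (w i)) \<le> M" if "i < N" for i
    using chain[of i N] that unfolding W_def prec_def by auto
  have far: "le (w i) V \<and> M < d (w i) (pr (w i) x) (pr (w i) y)" if i: "i < N" for i
  proof -
    have "d (w i) (pr (w i) y) (ro W (w i)) \<le> M"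
      using yW[of "w i"] tvW(1)[OF i] wI[of i] i tv_sym[of "w i" W] W(1) unfolding tv_def by auto
    then have "d (w i) (pr (w i) y) (be (w i)) \<le> 2 * M"
      using tvW(2)[OF i] d_tri[of "w i" "pr (w i) y" "be (w i)" "ro W (w i)"]
        d_sym[of "w i" "be (w i)" "ro W (w i)"] by linarith
    moreover have "d (w i) (pr (w i) x) (be (w i)) > 4 * M" using w[of i] i c by auto
    ultimately show ?thesis
      using d_tri[of "w i" "pr (w i) x" "be (w i)" "pr (w i) y"] M1 wI[of i] i by force
  qed
  have "\<exists>T\<in>I. le T V \<and> (\<exists>S\<in>w ` {..<N}. le S T \<and> S \<noteq> T) \<and>
      2 * C + 2 * c + 2 * M < d T (pr T x) (pr T y)"
  proof (rule N[OF yX])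
    show "N \<le> card (w ` {..<N})" using card_image[OF inj] by simp
    show "w ` {..<N} \<subseteq> I" using wI by auto
    show "\<forall>S\<in>w ` {..<N}. le S V \<and> M < d S (pr S x) (pr S y)" using far by auto
  qed simp
  then obtain S i where S: "S \<in> I" "le S V" "i < N" "le (w i) S" "w i \<noteq> S"
    and dS: "2 * C + 2 * c + 2 * M < d S (pr S x) (pr S y)" by auto
  have tri: "d S (pr S x) (pr S y) \<le> d S (pr S x) (be S) + d S (pr S y) (be S)"
    using d_tri[of S "pr S x" "pr S y" "be S"] d_sym[of S "pr S y" "be S"] by simp
  \<comment> \<open>The threshold for \<open>S\<close> is calibrated to these cases. In the first,
    both points are within \<open>C\<close> of the tuple. In the second, \<open>y\<close> is within
    \<open>C + 2 * M\<close>, since \<open>W\<close> is bad and \<open>V\<close> is not. In the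
    third, maximality of \<open>w i\<close> bounds the error of \<open>x\<close> by
    \<open>c\<close>; then \<open>y\<close> is so far that \<open>be S\<close> is far from
    \<open>ro W S\<close>, and the badness of \<open>W\<close> would pass to
    \<open>S\<close>.\<close>
  consider "\<exists>U\<in>F. \<not> orth S U" | "S = V" | "S \<in> perp V F" using S unfolding perp_def by blast
  then show False
  proof cases
    case 1
    then have "d S (pr S x) (be S) \<le> C" "d S (pr S y) (be S) \<le> C"
      using xg[OF S(1,2)] gg yF S unfolding gengood_def by blast+
    then show False using tri dS c M1 by linarith
  next
    case 2
    have "\<not> orth W V" using orth_not_le W V by blast
    moreover have "\<not> le V W" using le_antisym W V by blast
    ultimately have "d V (pr V y) (ro W V) \<le> M" using yW V by blast
    moreover have "\<not> d V (be V) (ro W V) > C + M"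
      using nested_far[OF be x W(1) V W(2,3), of C] W(5) xV c M1 by linarith
    ultimately have "d V (pr V y) (be V) \<le> C + 2 * M"
      using d_tri[of V "pr V y" "be V" "ro W V"] d_sym[of V "be V" "ro W V"] by linarith
    then show False using tri dS xV 2 c M1 by simp
  next
    case 3
    have wi: "w i \<in> I" "tv (w i) W" using wI tvW S(3) by auto
    have xS: "d S (pr S x) (be S) \<le> c" using w[of i] S 3 by force
    have "\<not> le S W" using le_trans[OF wi(1) S(1) W(1) S(4)] wi(2) unfolding tv_def by blast
    moreover have no: "\<not> orth S W"
      using orth_down[OF wi(1) S(1) W(1) S(4)] wi(2) unfolding tv_def by blast
    ultimately have "d S (pr S y) (ro W S) \<le> M" using yW S(1) W(1) orth_sym by blast
    then have fS: "d S (be S) (ro W S) > c + M"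
      using tri dS xS C d_tri[of S "pr S y" "be S" "ro W S"] d_sym[of S "be S" "ro W S"] by linarith
    show False
    proof (cases "le W S")
      case True
      have "W \<noteq> S" using \<open>\<not> le S W\<close> le_refl S(1) by blast
      then show False
        using nested_far[OF be x W(1) S(1) True, of c] W(5) fS xS c M1 by linarith
    next
      case False
      then have "tv W S" using \<open>\<not> le S W\<close> no orth_sym S(1) W(1) unfolding tv_def by blast
      then show False
        using transverse_far(2)[OF be x W(1) S(1), of c] W(5) fS xS c M1 by linarith
    qed
  qed
qed

section \<open>Extending an orthogonal family\<close>

text \<open>A coordinate \<open>T\<close> violating the new invariant is orthogonal to
  \<open>F\<close>, since \<open>F\<close> satisfies the old one, and not below \<open>W\<close>,
  since \<open>G\<close> is good there; so it fails to be orthogonal to some \<open>U\<close> in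
  \<open>G\<close>. The realization point is then near \<open>ro U T\<close>, hence near
  \<open>ro W T\<close>. Thus \<open>be T\<close> is far from \<open>ro W T\<close>, and the badness
  of \<open>W\<close> at \<open>x\<close> passes to \<open>T\<close>.\<close>

lemma successor:
  assumes be: "be \<in> Be" and V: "V \<in> I" and F: "ofam V F"
    and gg: "gengood be V F C" and x: "x \<in> X"
    and xV: "d V (pr V x) (be V) \<le> C"
    and c: "c \<ge> 4 * M" and C: "C \<ge> 0"
    and W: "W \<in> perp V F" "d W (pr W x) (be W) > c"
    and G: "ofam W G" "good be W G \<theta>"
    and bad: "\<not> gengood be V (F \<union> G) (max \<theta> (max c C + 3 * M))"
  shows "\<exists>T\<in>perp V F. d T (pr T x) (be T) > c \<and> (le W T \<and> W \<noteq> T \<or> prec be W T)"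
proof -
  obtain z T U where z: "rz be (F \<union> G) z" and T: "T \<in> I" "le T V"
    and U: "U \<in> F \<union> G" "\<not> orth T U" and "\<not> d T (pr T z) (be T) \<le> max \<theta> (max c C + 3 * M)"
    using bad unfolding gengood_def by blast
  then have zT: "d T (pr T z) (be T) > \<theta>" "d T (pr T z) (be T) > max c C + 3 * M" by auto
  have zF: "rz be F z" and zG: "rz be G z" using z rz_mono by blast+
  have WI: "W \<in> I" "le W V" "W \<noteq> V" using W(1) unfolding perp_def by auto
  have TF: "orth T U" if "U \<in> F" for U
  proof (rule ccontr)
    assume "\<not> orth T U"
    then have "d T (pr T z) (be T) \<le> C" using gg zF T that unfolding gengood_def by blast
    then show False using zT(2) M1 by simp
  qed
  then have UG: "U \<in> G" using U by blast
  then have UI: "U \<in> I" "le U W" using G(1) unfolding ofam_def by auto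
  have TW: "\<not> le T W" using G(2) zG T(1) zT(1) unfolding good_def by force
  have oTW: "\<not> orth T W" using orth_down[OF UI(1) WI(1) T(1) UI(2)] U(2) orth_sym UI(1) WI(1) T(1) by blast
  then have oWT: "\<not> orth W T" using orth_sym T WI by blast
  have TU: "\<not> le T U" using TW le_trans[OF T(1) UI(1) WI(1) _ UI(2)] by blast
  have "\<not> orth U T" using U(2) orth_sym UI(1) T(1) by blast
  then have zU: "d T (pr T z) (ro U T) \<le> M" using zG UG T(1) TU unfolding rz_def by blast
  have "d T (ro U T) (ro W T) \<le> M"
  proof (cases "le W T")
    case True
    then show ?thesis using ro_nested[OF UI(1) WI(1) T(1) UI(2)] TW le_refl WI(1) by blast
  next
    case False
    then show ?thesis using ro_transverse[OF UI(1) WI(1) T(1) UI(2)] TW oWT U(2) by blast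
  qed
  \<comment> \<open>Of the margin \<open>3 * M\<close>, one \<open>M\<close> leads from
    \<open>z\<close> to \<open>ro U T\<close>, one from there to \<open>ro W T\<close>, and the last
    is the slack in \<open>nested_far\<close> and \<open>transverse_far\<close>.\<close>
  then have far: "d T (be T) (ro W T) > max c C + M"
    using zU zT(2) d_tri[of T "pr T z" "be T" "ro U T"] d_tri[of T "ro U T" "be T" "ro W T"]
      d_sym[of T "be T" "ro W T"] by linarith
  have Wbad: "d W (pr W x) (be W) > M" "d W (pr W x) (be W) > 2 * M" using W(2) c M1 by linarith+
  have "d T (pr T x) (be T) > max c C \<and> (le W T \<and> W \<noteq> T \<or> prec be W T)"
  proof (cases "le W T")
    case True
    have "W \<noteq> T" using TW le_refl WI(1) by blast
    then show ?thesis using nested_far[OF be x WI(1) T(1) True _ Wbad(1) far] True by blast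
  next
    case False
    then have "tv W T" using TW oWT unfolding tv_def by blast
    then show ?thesis
      using transverse_far[OF be x WI(1) T(1) _ Wbad(2) far] C by simp
  qed
  \<comment> \<open>The maximum with \<open>C\<close> separates \<open>T\<close> from
    \<open>V\<close>, where \<open>x\<close> is within \<open>C\<close> of the tuple.\<close>
  moreover from this have "T \<noteq> V" using xV by auto
  ultimately show ?thesis using T TF unfolding perp_def by auto
qed

text \<open>Chains have to stay among maximal bad coordinates. Maximality of \<open>W\<close> leaves
  only the case \<open>prec be W T\<close>; enlarging \<open>T\<close> to a maximal \<open>S\<close>
  keeps it transverse to \<open>W\<close> and moves \<open>ro T W\<close> by at most
  \<open>M\<close>, so the order is preserved.\<close>

lemma maximal_successor:
  assumes be: "be \<in> Be" and x: "x \<in> X" and B: "B \<subseteq> I"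
    and c: "\<And>T. T \<in> B \<Longrightarrow> d T (pr T x) (be T) > 4 * M"
    and W: "W \<in> B" "\<forall>R\<in>B. le W R \<longrightarrow> R = W"
    and T: "T \<in> B" "le W T \<and> W \<noteq> T \<or> prec be W T"
  shows "\<exists>S\<in>B. prec be W S \<and> (\<forall>R\<in>B. le S R \<longrightarrow> R = S)"
proof -
  have p: "prec be W T" using W T by blast
  then have tWT: "tv W T" unfolding prec_def by simp
  obtain S where S: "S \<in> B" "le T S" "\<forall>R\<in>B. le S R \<longrightarrow> R = S"
    using maximal_above[OF B T(1)] by blast
  have I: "W \<in> I" "T \<in> I" "S \<in> I" using W T S B by auto
  have "\<not> le W S" using W(2) S tWT unfolding tv_def by blast
  moreover have "\<not> le S W" using le_trans[OF I(2,3,1) S(2)] tWT unfolding tv_def by blast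
  moreover have "\<not> orth S W" "\<not> orth W S" "\<not> orth W T"
    using orth_down[OF I(2,3,1) S(2)] orth_sym I tWT unfolding tv_def by blast+
  ultimately have t: "tv W S" and "d W (ro T W) (ro S W) \<le> M"
    using ro_transverse[OF I(2,3,1) S(2)] unfolding tv_def by blast+
  moreover have "d W (be W) (ro T W) \<le> M" using p unfolding prec_def by simp
  ultimately have "d W (pr W x) (ro S W) > M"
    using c[OF W(1)] d_tri[of W "be W" "ro S W" "ro T W"]
      d_tri[of W "pr W x" "be W" "ro S W"] d_sym[of W "be W" "ro S W"] M1 by linarith
  then have "prec be W S" using precI_point[OF be x I(1,3) t] c[OF S(1)] M1 by simp
  then show ?thesis using S by blast
qed

text \<open>The point \<open>x\<close> only has to be close to the tuple in \<open>V\<close> and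
  where some member of \<open>F\<close> is not orthogonal. This also covers the start at a new
  level, where \<open>F\<close> is empty and \<open>x\<close> realizes \<open>{V}\<close>. The
  length bound \<open>N\<close> occurs only inside the contradiction, so the new constant is
  explicit.\<close>

lemma extend:
  assumes be: "be \<in> Be" and V: "V \<in> I" and F: "ofam V F"
    and gg: "gengood be V F C" and x: "x \<in> X"
    and xV: "d V (pr V x) (be V) \<le> C"
    and xg: "\<And>T U. T \<in> I \<Longrightarrow> le T V \<Longrightarrow> U \<in> F \<Longrightarrow> \<not> orth T U \<Longrightarrow> d T (pr T x) (be T) \<le> C"
    and c: "c \<ge> 4 * M" and C: "C \<ge> 0"
    and IH: "\<And>W. W \<in> I \<Longrightarrow> le W V \<Longrightarrow> W \<noteq> V \<Longrightarrow> \<exists>G. G \<noteq> {} \<and> ofam W G \<and> good be W G \<theta>"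
    and W0: "W0 \<in> perp V F" "d W0 (pr W0 x) (be W0) > c"
  shows "\<exists>W\<in>perp V F. \<exists>G. G \<noteq> {} \<and> ofam W G \<and> gengood be V (F \<union> G) (max \<theta> (max c C + 3 * M))"
proof (rule ccontr)
  assume neg: "\<not> ?thesis"
  define B where "B = {T \<in> perp V F. d T (pr T x) (be T) > c}"
  have BI: "B \<subseteq> I" unfolding B_def perp_def by blast
  have Bc: "d T (pr T x) (be T) > 4 * M" if "T \<in> B" for T using that c unfolding B_def by auto
  define P where "P W \<longleftrightarrow> W \<in> B \<and> (\<forall>R\<in>B. le W R \<longrightarrow> R = W)" for W
  have step: "\<exists>S. P S \<and> prec be W S" if "P W" for W
  proof -
    have W: "W \<in> perp V F" "d W (pr W x) (be W) > c" "W \<in> B" "\<forall>R\<in>B. le W R \<longrightarrow> R = W"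
      using that unfolding P_def B_def by auto
    then obtain G where G: "G \<noteq> {}" "ofam W G" "good be W G \<theta>"
      using IH[of W] unfolding perp_def by blast
    then have "\<not> gengood be V (F \<union> G) (max \<theta> (max c C + 3 * M))" using neg W(1) by blast
    then obtain T where "T \<in> B" "le W T \<and> W \<noteq> T \<or> prec be W T"
      using successor[OF be V F gg x xV c C W(1,2) G(2,3)] unfolding B_def by blast
    then show ?thesis using maximal_successor[OF be x BI Bc W(3,4)] unfolding P_def by blast
  qed
  obtain W1 where W1: "P W1"
    using maximal_above[OF BI, of W0] W0 unfolding P_def B_def by blast
  obtain w where w: "\<And>i. P (w i)" "\<And>i. prec be (w i) (w (Suc i))"
    using dependent_nat_choice[of "\<lambda>_. P" "\<lambda>_. prec be"] W1 step by metis
  have chain: "prec be (w i) (w j)" if "i < j" for i j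
    using that
  proof (induction j)
    case (Suc j)
    have I: "w k \<in> I" "d (w k) (pr (w k) x) (be (w k)) > 4 * M" for k
      using w(1)[of k] BI Bc unfolding P_def by auto
    show ?case
    proof (cases "i = j")
      case False
      then have "prec be (w i) (w j)" using Suc by simp
      then show ?thesis using prec_trans[OF be x I(1) I(1) I(1) _ w(2) I(2) I(2) I(2)] by blast
    qed (simp add: w(2))
  qed simp
  obtain N where N: "\<And>\<S> y. y \<in> X \<Longrightarrow> finite \<S> \<Longrightarrow> \<S> \<subseteq> I \<Longrightarrow> N \<le> card \<S> \<Longrightarrow>
     (\<forall>S\<in>\<S>. le S V \<and> M < d S (pr S x) (pr S y)) \<Longrightarrow>
     (\<exists>T\<in>I. le T V \<and> (\<exists>S\<in>\<S>. le S T \<and> S \<noteq> T) \<and> 2 * C + 2 * c + 2 * M < d T (pr T x) (pr T y))"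
    using passing_up[of "Suc (lev V)" "2 * C + 2 * c + 2 * M"] V x
    by (elim exE) (blast intro: lessI)
  have wP: "w i \<in> perp V F \<and> d (w i) (pr (w i) x) (be (w i)) > c \<and>
        (\<forall>S\<in>perp V F. d S (pr S x) (be S) > c \<longrightarrow> le (w i) S \<longrightarrow> S = w i)" for i
    using w(1)[of i] unfolding P_def B_def by blast
  show False
    by (rule no_long_chain[where w = w and N = N, OF be V F gg x xV xg c C wP chain N])
qed

section \<open>Induction on levels\<close>

definition good_below :: "('s \<Rightarrow> 'c) \<Rightarrow> 's \<Rightarrow> real \<Rightarrow> bool" where
  "good_below be V \<theta> \<longleftrightarrow>
     (\<forall>W\<in>I. le W V \<longrightarrow> W \<noteq> V \<longrightarrow> (\<exists>G. G \<noteq> {} \<and> ofam W G \<and> good be W G \<theta>))"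

text \<open>
  The element \<open>Z\<close> contains everything that is still orthogonal to the family \<open>F\<close>; extending \<open>F\<close>
  replaces it by a container of smaller level, so only boundedly many extensions are needed.
\<close>

lemma gengood_to_good:
  assumes C: "C \<ge> 0"
  shows "\<exists>C'. \<forall>be\<in>Be. \<forall>V\<in>I. \<forall>Z\<in>I. \<forall>F.
    good_below be V \<theta> \<longrightarrow>
    lev Z < m \<longrightarrow> F \<noteq> {} \<longrightarrow> ofam V F \<longrightarrow> perp V F \<subseteq> {T. le T Z} \<longrightarrow> gengood be V F C \<longrightarrow>
    (\<exists>G. G \<noteq> {} \<and> ofam V G \<and> good be V G C')"
  using C
proof (induction m arbitrary: C)
  case 0
  then show ?case by simp
next
  case (Suc m)
  \<comment> \<open>With \<open>c\<close> at least \<open>C\<close>, the invariant forces every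
    coordinate of error above \<open>c\<close> into \<open>perp V F\<close>; transitivity of
    \<open>prec\<close> needs \<open>4 * M\<close>.\<close>
  define c where "c = max C (4 * M)"
  define C2 where "C2 = max \<theta> (max c C + 3 * M)"
  have c: "c \<ge> 4 * M" "c \<ge> C" "C2 \<ge> 0"
    using Suc.prems M1 unfolding c_def C2_def by linarith+
  obtain C' where IH: "\<forall>be\<in>Be. \<forall>V\<in>I. \<forall>Z\<in>I. \<forall>F. good_below be V \<theta> \<longrightarrow>
    lev Z < m \<longrightarrow> F \<noteq> {} \<longrightarrow> ofam V F \<longrightarrow> perp V F \<subseteq> {T. le T Z} \<longrightarrow> gengood be V F C2 \<longrightarrow>
    (\<exists>G. G \<noteq> {} \<and> ofam V G \<and> good be V G C')"
    using Suc.IH[OF c(3)] by (rule exE)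
  show ?case
  proof (intro exI[of _ "max C' (max c C2)"] ballI allI impI)
    fix be V Z F
    assume be: "be \<in> Be" and V: "V \<in> I" and Z: "Z \<in> I"
      and fam: "good_below be V \<theta>"
      and lZ: "lev Z < Suc m" and ne: "F \<noteq> {}" and F: "ofam V F"
      and FZ: "perp V F \<subseteq> {T. le T Z}" and gg: "gengood be V F C"
    have nV: "\<not> orth V U \<and> le U V" if "U \<in> F" for U
      using that F orth_not_le[of U V] orth_sym V unfolding ofam_def by blast
    have ggC: "d T (pr T x) (be T) \<le> C" if "rz be F x" "T \<in> I" "le T V" "T \<notin> perp V F" for x T
    proof -
      have "\<exists>U\<in>F. \<not> orth T U" using that ne nV unfolding perp_def by blast
      then show ?thesis using gg that unfolding gengood_def by blast
    qed
    show "\<exists>G. G \<noteq> {} \<and> ofam V G \<and> good be V G (max C' (max c C2))"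
    proof (cases "good be V F c")
      case True
      then show ?thesis using ne F good_mono[OF True, of "max C' (max c C2)"] by auto
    next
      case False
      then obtain x W0 where x: "rz be F x" and W0: "W0 \<in> I" "le W0 V" "d W0 (pr W0 x) (be W0) > c"
        unfolding good_def by force
      then have W0p: "W0 \<in> perp V F" using ggC[OF x W0(1,2)] c by fastforce
      have xV: "d V (pr V x) (be V) \<le> C"
        using ggC[OF x V] le_refl[OF V] unfolding perp_def by blast
      have xg: "d T (pr T x) (be T) \<le> C" if "T \<in> I" "le T V" "U \<in> F" "\<not> orth T U" for T U
        using ggC[OF x that(1,2)] that unfolding perp_def by blast
      have "\<exists>W\<in>perp V F. \<exists>G. G \<noteq> {} \<and> ofam W G \<and>
          gengood be V (F \<union> G) (max \<theta> (max c C + 3 * M))"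
        by (rule extend[OF be V F gg rz_X[OF x] xV _ c(1) Suc.prems _ W0p W0(3)])
          (use fam xg in \<open>auto simp: good_below_def\<close>)
      then obtain W G where W: "W \<in> perp V F"
        and G: "G \<noteq> {}" "ofam W G" "gengood be V (F \<union> G) C2"
        unfolding C2_def by blast
      have FG: "ofam V (F \<union> G)" by (rule ofam_Un[OF F W V G(2)])
      obtain U where U: "U \<in> G" using G(1) by blast
      then have UI: "U \<in> I" "le U W" "W \<in> I" "le W Z"
        using G(2) W FZ unfolding ofam_def perp_def by auto
      have UZ: "le U Z" using le_trans[OF UI(1,3) Z] UI by blast
      have sub: "perp V (F \<union> G) \<subseteq> perp V F" unfolding perp_def by blast
      show ?thesis
      \<comment> \<open>The container axiom needs something orthogonal to \<open>U\<close>. If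
        nothing remains, the invariant already covers all coordinates below \<open>V\<close>,
        including \<open>V\<close> itself because \<open>F\<close> is nonempty.\<close>
      proof (cases "perp V (F \<union> G) = {}")
        case True
        have "good be V (F \<union> G) C2"
          unfolding good_def
        proof (intro allI impI ballI)
          fix z T assume z: "rz be (F \<union> G) z" and T: "T \<in> I" "le T V"
          have "\<exists>U\<in>F \<union> G. \<not> orth T U" using True T ne nV unfolding perp_def by blast
          then show "d T (pr T z) (be T) \<le> C2" using G(3) z T unfolding gengood_def by blast
        qed
        then have "good be V (F \<union> G) (max C' (max c C2))" by (rule good_mono) simp
        then show ?thesis using FG ne by blast
      next
        case False
        then obtain T0 where "T0 \<in> perp V (F \<union> G)" by blast
        then have T0: "T0 \<in> I" "le T0 Z" "orth T0 U" using FZ sub U unfolding perp_def by blast+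
        \<comment> \<open>All that remains lies below \<open>Z\<close> and is orthogonal to
          \<open>U\<close>, so the container can be taken properly below \<open>Z\<close>.\<close>
        obtain Z' where Z': "Z' \<in> I" "le Z' Z" "Z' \<noteq> Z"
          "\<forall>T\<in>I. le T Z \<longrightarrow> orth T U \<longrightarrow> le T Z'"
          using orth_container[OF Z UI(1) UZ T0] by blast
        have "perp V (F \<union> G) \<subseteq> {T. le T Z'}"
          using Z'(4) FZ sub U unfolding perp_def by blast
        moreover have "lev Z' < m" using lev_less[OF Z'(1) Z Z'(2,3)] lZ by simp
        ultimately obtain G' where "G' \<noteq> {}" "ofam V G'" "good be V G' C'"
          using IH[rule_format, OF be V Z'(1) fam _ _ FG _ G(3)] ne by blast
        then show ?thesis using good_mono[of be V G' C' "max C' (max c C2)"] by auto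
      qed
    qed
  qed
qed

lemma good_exists:
  "\<exists>\<theta>. \<forall>be\<in>Be. \<forall>V\<in>I. lev V < m \<longrightarrow> (\<exists>G. G \<noteq> {} \<and> ofam V G \<and> good be V G \<theta>)"
proof (induction m)
  case 0
  then show ?case by simp
next
  case (Suc m)
  then obtain \<theta> where \<theta>: "\<And>be V. be \<in> Be \<Longrightarrow> V \<in> I \<Longrightarrow> lev V < m \<Longrightarrow>
      \<exists>G. G \<noteq> {} \<and> ofam V G \<and> good be V G \<theta>" by blast
  define c where "c = 4 * M"
  define C2 where "C2 = max \<theta> (max c M + 3 * M)"
  have "C2 \<ge> 0" using M1 unfolding C2_def by linarith
  obtain C' where C': "\<forall>be\<in>Be. \<forall>V\<in>I. \<forall>Z\<in>I. \<forall>F. good_below be V \<theta> \<longrightarrow>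
    lev Z < Suc m \<longrightarrow> F \<noteq> {} \<longrightarrow> ofam V F \<longrightarrow> perp V F \<subseteq> {T. le T Z} \<longrightarrow> gengood be V F C2 \<longrightarrow>
    (\<exists>G. G \<noteq> {} \<and> ofam V G \<and> good be V G C')"
    using gengood_to_good[OF \<open>C2 \<ge> 0\<close>] by (rule exE)
  show ?case
  proof (intro exI[of _ "max c C'"] ballI impI)
    fix be V assume be: "be \<in> Be" and V: "V \<in> I" and lV: "lev V < Suc m"
    have fam: "good_below be V \<theta>"
      unfolding good_below_def
    proof (intro ballI impI)
      fix W assume "W \<in> I" "le W V" "W \<noteq> V"
      then show "\<exists>G. G \<noteq> {} \<and> ofam W G \<and> good be W G \<theta>"
        using \<theta>[OF be] lev_less[of W V] V lV by simp
    qed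
    have VV: "ofam V {V}" using V le_refl unfolding ofam_def by simp
    show "\<exists>G. G \<noteq> {} \<and> ofam V G \<and> good be V G (max c C')"
    \<comment> \<open>If \<open>{V}\<close> fails, it cannot be extended, as nothing below
      \<open>V\<close> is orthogonal to \<open>V\<close>. The construction restarts from the empty
      family, whose invariant is vacuous, and keeps only the point realizing
      \<open>{V}\<close>.\<close>
    proof (cases "good be V {V} c")
      case True
      then show ?thesis using VV good_mono[OF True, of "max c C'"] by auto
    next
      case False
      then obtain x W0 where x: "rz be {V} x" and W0: "W0 \<in> I" "le W0 V" "d W0 (pr W0 x) (be W0) > c"
        unfolding good_def by force
      have xV: "d V (pr V x) (be V) \<le> M" using x unfolding rz_def by blast
      have "W0 \<noteq> V" using W0(3) xV M1 unfolding c_def by auto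
      then have W0p: "W0 \<in> perp V {}" using W0 unfolding perp_def by simp
      have e: "ofam V {}" "gengood be V {} M" unfolding ofam_def gengood_def by auto
      have "\<exists>W\<in>perp V {}. \<exists>G. G \<noteq> {} \<and> ofam W G \<and>
          gengood be V ({} \<union> G) (max \<theta> (max c M + 3 * M))"
        by (rule extend[OF be V e rz_X[OF x] xV _ _ _ _ W0p W0(3)])
          (use fam M1 in \<open>auto simp: c_def good_below_def\<close>)
      then obtain W G where W: "W \<in> perp V {}" and G: "G \<noteq> {}" "ofam W G" "gengood be V G C2"
        unfolding C2_def by auto
      have VG: "ofam V G" using ofam_Un[OF e(1) W V G(2)] by simp
      have "perp V G \<subseteq> {T. le T V}" unfolding perp_def by blast
      then obtain G' where "G' \<noteq> {}" "ofam V G'" "good be V G' C'"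
        using C'[rule_format, OF be V V fam lV G(1) VG _ G(3)] by blast
      then show ?thesis using good_mono[of be V G' C' "max c C'"] by auto
    qed
  qed
qed

text \<open>Bounded levels put some maximal element above every index, and uniqueness identifies it
  with \<open>S\<close>.\<close>

lemma maximal_is_greatest:
  assumes "S \<in> I" "\<And>M V. M \<in> I \<Longrightarrow> (\<forall>V\<in>I. le M V \<longrightarrow> V = M) \<Longrightarrow> M = S" "V \<in> I"
  shows "le V S"
  using maximal_above[of I V] assms by blast

lemma realization_point:
  assumes S: "\<And>V. V \<in> I \<Longrightarrow> le V S" "S \<in> I"
  shows "\<exists>\<theta>. \<forall>be\<in>Be. \<exists>x\<in>X. \<forall>W\<in>I. d W (pr W x) (be W) \<le> \<theta>"
proof -
  obtain \<theta> where \<theta>: "\<forall>be\<in>Be. \<forall>V\<in>I. lev V < Suc (lev S) \<longrightarrow>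
      (\<exists>G. G \<noteq> {} \<and> ofam V G \<and> good be V G \<theta>)"
    using good_exists by blast
  show ?thesis
  proof (intro exI[of _ \<theta>] ballI)
    fix be assume be: "be \<in> Be"
    then obtain G where G: "ofam S G" "good be S G \<theta>" using \<theta> S(2) by blast
    then obtain x where "rz be G x" using rz_ex[OF be] by blast
    then show "\<exists>x\<in>X. \<forall>W\<in>I. d W (pr W x) (be W) \<le> \<theta>"
      using G(2) S(1) rz_X unfolding good_def by blast
  qed
qed

end

section \<open>Set distances and levels\<close>

text \<open>The infimum need not be attained, which costs the additional 1 here and in later
  bounds.\<close>

lemma set_dist_le_obtain:
  assumes "set_dist d A B \<le> ennreal r" "r \<ge> 0"
  obtains a b where "a \<in> A" "b \<in> B" "d a b < r + 1"
proof -
  have "set_dist d A B < ennreal (r + 1)"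
    using assms by (intro le_less_trans[OF assms(1)] ennreal_lessI) auto
  then obtain a where a: "a \<in> A" "(INF b\<in>B. ennreal (d a b)) < ennreal (r + 1)"
    unfolding set_dist_def by (auto simp: INF_less_iff)
  then obtain b where b: "b \<in> B" "ennreal (d a b) < ennreal (r + 1)"
    by (auto simp: INF_less_iff)
  then have "d a b < r + 1" using assms(2) by (cases "d a b \<ge> 0") (auto simp: ennreal_less_iff simp del: ennreal_plus)
  then show ?thesis using that a b by blast
qed

lemma set_dist_le: "a \<in> A \<Longrightarrow> b \<in> B \<Longrightarrow> set_dist d A B \<le> ennreal (d a b)"
  unfolding set_dist_def by (intro INF_lower2[of a] INF_lower) auto

lemma set_diam_leD:
  assumes "set_diam d A \<le> ennreal r" "r \<ge> 0" "a \<in> A" "b \<in> A"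
  shows "d a b \<le> r"
proof -
  have "ennreal (d a b) \<le> set_diam d A"
    unfolding set_diam_def using assms(3,4) by (intro SUP_upper2[of a] SUP_upper) auto
  then show ?thesis using assms(1,2) ennreal_le_iff by (meson order_trans)
qed

lemma set_dist_leD:
  assumes "Metric_space C d" "A \<subseteq> C" "B \<subseteq> C" "set_diam d A \<le> ennreal s" "set_diam d B \<le> ennreal t"
    and "set_dist d A B \<le> ennreal r" "s \<ge> 0" "t \<ge> 0" "r \<ge> 0" "a \<in> A" "b \<in> B"
  shows "d a b \<le> s + t + r + 1"
proof -
  interpret Metric_space C d by fact
  obtain a' b' where ab: "a' \<in> A" "b' \<in> B" "d a' b' < r + 1"
    using set_dist_le_obtain[OF assms(6,9)] by blast
  have "d a a' \<le> s" "d b' b \<le> t" using set_diam_leD assms ab by metis+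
  moreover have "d a b \<le> d a a' + d a' b" "d a' b \<le> d a' b' + d b' b"
    using triangle assms(2,3,10,11) ab by blast+
  ultimately show ?thesis using ab(3) by linarith
qed

lemma set_diam_singleton: "Metric_space C d \<Longrightarrow> a \<in> C \<Longrightarrow> set_diam d {a} \<le> ennreal 0"
  unfolding set_diam_def using Metric_space.zero[of C d a a] by simp

text \<open>The level of \<open>W\<close> is the largest size of a chain below \<open>W\<close>; a
  chain below \<open>V\<close> grows by \<open>W\<close> when \<open>V\<close> is properly nested in
  \<open>W\<close>.\<close>

lemma level_function:
  fixes I :: "'s set" and le :: "'s \<Rightarrow> 's \<Rightarrow> bool"
  assumes refl: "reflp_on I le" and antisym: "antisymp_on I le" and trans: "transp_on I le"
    and fin: "\<And>A. A \<subseteq> I \<Longrightarrow> (\<forall>V\<in>A. \<forall>W\<in>A. le V W \<or> le W V) \<Longrightarrow> finite A \<and> card A \<le> n"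
  shows "\<exists>lev. (\<forall>V\<in>I. \<forall>W\<in>I. le V W \<longrightarrow> V \<noteq> W \<longrightarrow> lev V < lev W) \<and> (\<forall>W\<in>I. lev W \<le> n)"
proof -
  define chains where
    "chains W = {A. A \<subseteq> {V \<in> I. le V W} \<and> (\<forall>V\<in>A. \<forall>W\<in>A. le V W \<or> le W V)}" for W
  define lev where "lev W = Max (card ` chains W)" for W
  have sub: "card ` chains W \<subseteq> {..n}" for W using fin unfolding chains_def by blast
  have fin': "finite (card ` chains W)" for W using sub finite_subset by blast
  have ne: "{} \<in> chains W" for W unfolding chains_def by simp
  have le_n: "lev W \<le> n" for W
    using Max_in[OF fin'[of W]] ne sub unfolding lev_def by blast
  have "lev V < lev W" if VW: "V \<in> I" "W \<in> I" "le V W" "V \<noteq> W" for V W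
  proof -
    have "lev V \<in> card ` chains V" using Max_in[OF fin'[of V]] ne unfolding lev_def by blast
    then obtain A where A: "A \<in> chains V" "card A = lev V" by force
    have AI: "A \<subseteq> I" "\<forall>U\<in>A. le U V" using A(1) unfolding chains_def by auto
    have AW: "le U W" if "U \<in> A" for U
      using transp_onD[OF trans, of U V W] AI that VW by blast
    have "W \<notin> A" using antisymp_onD[OF antisym, of V W] AI VW by blast
    moreover have "finite A" using fin A(1) unfolding chains_def by blast
    ultimately have "card (insert W A) = Suc (lev V)" using A(2) by simp
    moreover have "insert W A \<in> chains W"
      using A(1) AW AI VW(2) reflp_onD[OF refl, of W] unfolding chains_def by auto
    then have "card (insert W A) \<le> lev W" using fin'[of W] unfolding lev_def by simp
    ultimately show ?thesis by simp
  qed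
  then show ?thesis using le_n by blast
qed

section \<open>From hierarchical spaces to the coarse setting\<close>

lemma realization_bound:
  fixes H :: "('x, 's, 'c) hierarchy"
  assumes H: "hierarchical_space q H" and \<kappa>: "\<kappa> \<ge> 1"
  shows "\<exists>\<theta>\<ge>0. \<forall>b. consistent_tuple H \<kappa> b \<longrightarrow>
    (\<exists>x\<in>points H. \<forall>W\<in>index H. cset_dist H W (b W) (proj H W x) \<le> ennreal \<theta>)"
proof -
  obtain \<xi> K \<kappa>\<^sub>0 where c0: "\<xi> \<ge> 0" "\<kappa>\<^sub>0 \<ge> 0"
    and hp: "hs_projections H \<xi> K" and hn: "hs_nesting H \<xi>" and ho: "hs_orthogonality H"
    and hc: "hs_consistency H \<xi> \<kappa>\<^sub>0" and hf: "hs_finite_complexity H"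
    and hl: "hs_large_links H \<xi> \<kappa>\<^sub>0"
    and hb: "hs_bounded_geodesic_image H" and hr: "hs_partial_realization H"
    and geo: "\<And>W. W \<in> index H \<Longrightarrow> geodesic_metric_space (cspace H W) (cdist H W)"
    using H unfolding hierarchical_space_def by blast
  obtain \<Lambda> E where LE: "\<Lambda> \<ge> 1" "E \<ge> max \<xi> \<kappa>\<^sub>0"
    and ll: "\<forall>W\<in>index H. \<forall>x\<in>points H. \<forall>x'\<in>points H.
           let N = \<Lambda> * enn2real (proj_dist H W x x') + \<Lambda> in
           \<exists>\<T>. \<T> \<subseteq> below H W - {W} \<and> finite \<T> \<and> int (card \<T>) \<le> \<lfloor>N\<rfloor> \<and>
             (\<forall>T\<in>below H W - {W}.
                (\<exists>T'\<in>\<T>. T \<in> below H T') \<or> proj_dist H T x x' < ennreal E) \<and>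
             (\<forall>T'\<in>\<T>. cset_dist H W (proj H W x) (rho_set H T' W) \<le> ennreal N)"
    using hl unfolding hs_large_links_def by blast
  obtain E' where "E' > 0 \<and> (\<forall>V\<in>index H. \<forall>W\<in>index H. psnested H V W \<longrightarrow>
        (\<forall>L g. geodesic_path (cspace H W) (cdist H W) L g \<longrightarrow>
           cset_diam H V (rho_image H W V (g ` {0..L})) \<le> ennreal E' \<or>
           (\<exists>t\<in>{0..L}. cset_dist H W {g t} (rho_set H V W) \<le> ennreal E')))"
    using hb unfolding hs_bounded_geodesic_image_def by (rule exE)
  note E' = conjunct1[OF this] and bgi = conjunct2[OF this]
  obtain \<alpha> where "\<alpha> \<ge> 0 \<and> (\<forall>F\<subseteq>index H. \<forall>p.
        (\<forall>V\<in>F. \<forall>W\<in>F. V \<noteq> W \<longrightarrow> orth H V W) \<longrightarrow> (\<forall>V\<in>F. p V \<in> proj_image H V) \<longrightarrow>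
        (\<exists>x\<in>points H.
           (\<forall>V\<in>F. cset_dist H V (proj H V x) {p V} \<le> ennreal \<alpha>) \<and>
           (\<forall>V\<in>F. \<forall>W\<in>index H. psnested H V W \<or> transverse H W V \<longrightarrow>
              cset_dist H W (proj H W x) (rho_set H V W) \<le> ennreal \<alpha>)))"
    using hr unfolding hs_partial_realization_def by (rule exE)
  note \<alpha> = conjunct1[OF this] and pre = conjunct2[OF this, THEN spec, THEN mp, THEN spec, THEN mp, THEN mp]
  obtain n where n: "\<And>A. A \<subseteq> index H \<Longrightarrow> (\<forall>V\<in>A. \<forall>W\<in>A. nested H V W \<or> nested H W V) \<Longrightarrow>
      finite A \<and> card A \<le> n"
    using hf unfolding hs_finite_complexity_def by blast
  have ord: "reflp_on (index H) (nested H)" "antisymp_on (index H) (nested H)"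
    "transp_on (index H) (nested H)" using hn unfolding hs_nesting_def by auto
  obtain lev :: "'s \<Rightarrow> nat" where lev: "\<forall>V\<in>index H. \<forall>W\<in>index H. nested H V W \<longrightarrow> V \<noteq> W \<longrightarrow> lev V < lev W"
    "\<forall>W\<in>index H. lev W \<le> n"
    using level_function[OF ord n] by blast
  \<comment> \<open>A sum large enough for all estimates \<open>A1\<close> to
    \<open>A6\<close>.\<close>
  define M where "M = 2 * \<xi> + \<kappa>\<^sub>0 + 3 * \<kappa> + E + E' + \<alpha> + 3"
  have E0: "E \<ge> 0" using LE c0 by simp
  have met: "Metric_space (cspace H W) (cdist H W)" if "W \<in> index H" for W
    using geo[OF that] unfolding geodesic_metric_space_def by blast
  have pj: "proj H W x \<subseteq> cspace H W" "proj H W x \<noteq> {}"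
    "set_diam (cdist H W) (proj H W x) \<le> ennreal \<xi>" if "W \<in> index H" "x \<in> points H" for W x
    using hp that unfolding hs_projections_def cset_diam_def by auto
  obtain x0 where x0: "x0 \<in> points H" using pre[of "{}"] by auto
  have pne: "\<exists>p. p \<in> proj_image H W" if "W \<in> index H" for W
    using pj(2)[OF that x0] x0 unfolding proj_image_def by blast

  define pr where "pr W x = (SOME p. p \<in> proj H W x)" for W x
  define ro where "ro V W = (SOME p. p \<in> rho_set H V W)" for V W
  \<comment> \<open>All tuples are handled at once, so that the bound obtained in the locale is
    uniform in \<open>b\<close>.\<close>
  define Be where "Be = {be. \<exists>b. consistent_tuple H \<kappa> b \<and> (\<forall>W\<in>index H. be W \<in> b W)}"
  \<comment> \<open>Retracting to \<open>cspace H W\<close> makes \<open>d W\<close> a pseudometric on the whole type.\<close>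
  define rt where "rt W p = (if p \<in> cspace H W then p else SOME c. c \<in> cspace H W)" for W p
  define d where "d W p r = (if W \<in> index H then cdist H W (rt W p) (rt W r) else 0)" for W p r
  have prm: "pr W x \<in> proj H W x" if "W \<in> index H" "x \<in> points H" for W x
    using pj(2)[OF that] some_in_eq unfolding pr_def by blast
  have prC: "pr W x \<in> cspace H W" if "W \<in> index H" "x \<in> points H" for W x
    using prm[OF that] pj(1)[OF that] by blast
  have rtC: "rt W p \<in> cspace H W" if "W \<in> index H" for W p
  proof -
    have "\<exists>c. c \<in> cspace H W" using prC[OF that x0] by blast
    then show ?thesis unfolding rt_def using someI_ex[of "\<lambda>c. c \<in> cspace H W"] by simp
  qed
  have d_eq: "d W p r = cdist H W p r" if "W \<in> index H" "p \<in> cspace H W" "r \<in> cspace H W" for W p r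
    using that unfolding d_def rt_def by simp
  have d_nonneg: "d W p r \<ge> 0" for W p r
    unfolding d_def using met Metric_space.nonneg by fastforce
  have d_sym: "d W p r = d W r p" for W p r
    unfolding d_def using met Metric_space.commute by fastforce
  have d_tri: "d W p r \<le> d W p s + d W s r" for W p r s
    unfolding d_def using Metric_space.triangle[OF met rtC rtC rtC] by simp
  have osym: "orth H W V" if "V \<in> index H" "W \<in> index H" "orth H V W" for V W
    using ho that unfolding hs_orthogonality_def by (blast dest: symp_onD)
  have tsym: "transverse H W V" if "V \<in> index H" "W \<in> index H" "transverse H V W" for V W
    using that osym unfolding transverse_def by blast
  have rh: "rho_set H V W \<subseteq> cspace H W" "set_diam (cdist H W) (rho_set H V W) \<le> ennreal \<xi>"
    if "V \<in> index H" "W \<in> index H" "psnested H V W \<or> transverse H V W" for V W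
    using that hn hc unfolding hs_nesting_def hs_consistency_def cset_diam_def by blast+
  have rhne: "rho_set H V W \<noteq> {}"
    if VW: "V \<in> index H" "W \<in> index H" "psnested H V W \<or> transverse H V W" for V W
  proof -
    obtain p where p: "p \<in> proj_image H V" using pne[OF VW(1)] by (rule exE)
    have "\<exists>x\<in>points H. (\<forall>V'\<in>{V}. cset_dist H V' (proj H V' x) {p} \<le> ennreal \<alpha>) \<and>
        (\<forall>V'\<in>{V}. \<forall>W\<in>index H. psnested H V' W \<or> transverse H W V' \<longrightarrow>
          cset_dist H W (proj H W x) (rho_set H V' W) \<le> ennreal \<alpha>)"
      by (rule pre) (use VW(1) p in auto)
    moreover have "psnested H V W \<or> transverse H W V" using VW(3) tsym[OF VW(1,2)] by blast
    ultimately obtain x where x: "cset_dist H W (proj H W x) (rho_set H V W) \<le> ennreal \<alpha>"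
      using VW(2) by blast
    show ?thesis
      using set_dist_le_obtain[OF x[unfolded cset_dist_def] \<alpha>] by blast
  qed
  have rom: "ro V W \<in> rho_set H V W" "ro V W \<in> cspace H W"
    if "V \<in> index H" "W \<in> index H" "psnested H V W \<or> transverse H V W" for V W
    using rhne[OF that] rh(1)[OF that] some_in_eq unfolding ro_def by blast+
  have pr_ro: "d W (pr W x) (ro V W) \<le> 2 * \<xi> + r + 1"
    if "V \<in> index H" "W \<in> index H" "psnested H V W \<or> transverse H V W" "x \<in> points H" "r \<ge> 0"
      "cset_dist H W (proj H W x) (rho_set H V W) \<le> ennreal r" for V W x r
    using set_dist_leD[OF met[OF that(2)] pj(1)[OF that(2,4)] rh(1)[OF that(1-3)]
        pj(3)[OF that(2,4)] rh(2)[OF that(1-3)] that(6)[unfolded cset_dist_def] c0(1,1) that(5)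
        prm[OF that(2,4)] rom(1)[OF that(1-3)]]
      d_eq[OF that(2) prC[OF that(2,4)] rom(2)[OF that(1-3)]] by linarith
  have Bex: "\<exists>b. consistent_tuple H \<kappa> b \<and> (\<forall>W\<in>index H. be W \<in> b W)" if "be \<in> Be" for be
    using that unfolding Be_def by blast
  have bC: "b W \<subseteq> cspace H W" "set_diam (cdist H W) (b W) \<le> ennreal \<kappa>"
    "set_dist (cdist H W) (b W) (proj_image H W) \<le> ennreal \<kappa>"
    if "consistent_tuple H \<kappa> b" "W \<in> index H" for b W
    using that unfolding consistent_tuple_def cset_diam_def cset_dist_def by blast+
  have be_ro: "d W (be W) (ro V W) \<le> 2 * \<kappa> + \<xi> + 1"
    if "consistent_tuple H \<kappa> b" "be W \<in> b W"
      "V \<in> index H" "W \<in> index H" "psnested H V W \<or> transverse H V W"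
      "cset_dist H W (b W) (rho_set H V W) \<le> ennreal \<kappa>" for V W b be
  proof -
    have "cdist H W (be W) (ro V W) \<le> \<kappa> + \<xi> + \<kappa> + 1"
      using set_dist_leD[OF met[OF that(4)] bC(1)[OF that(1,4)] rh(1)[OF that(3-5)]
          bC(2)[OF that(1,4)] rh(2)[OF that(3-5)] that(6)[unfolded cset_dist_def] _ c0(1) _
          that(2) rom(1)[OF that(3-5)]] \<kappa> by simp
    then show ?thesis
      using d_eq[OF that(4) _ rom(2)[OF that(3-5)], of "be W"] bC(1)[OF that(1,4)] that(2) by auto
  qed

  have A1: "d W (pr W x) (ro V W) \<le> M \<or> d V (pr V x) (ro W V) \<le> M"
    if "x \<in> points H" "V \<in> index H" "W \<in> index H" "transverse H V W" for x V W
  proof -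
    have "cset_dist H W (proj H W x) (rho_set H V W) \<le> ennreal \<kappa>\<^sub>0 \<or>
      cset_dist H V (proj H V x) (rho_set H W V) \<le> ennreal \<kappa>\<^sub>0"
      using hc that unfolding hs_consistency_def min_le_iff_disj by blast
    then have "d W (pr W x) (ro V W) \<le> 2 * \<xi> + \<kappa>\<^sub>0 + 1 \<or> d V (pr V x) (ro W V) \<le> 2 * \<xi> + \<kappa>\<^sub>0 + 1"
      using pr_ro[of V W x \<kappa>\<^sub>0] pr_ro[of W V x \<kappa>\<^sub>0] that tsym c0 by blast
    then show ?thesis using c0 E0 E' \<alpha> \<kappa> unfolding M_def by linarith
  qed
  have A2: "d W (be W) (ro V W) \<le> M \<or> d V (be V) (ro W V) \<le> M"
    if be: "be \<in> Be" and VW: "V \<in> index H" "W \<in> index H" "transverse H V W" for be V W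
  proof -
    obtain b where b: "consistent_tuple H \<kappa> b" "\<forall>W\<in>index H. be W \<in> b W" using Bex[OF be] by blast
    then have "cset_dist H W (b W) (rho_set H V W) \<le> ennreal \<kappa> \<or>
      cset_dist H V (b V) (rho_set H W V) \<le> ennreal \<kappa>"
      using VW unfolding consistent_tuple_def min_le_iff_disj by blast
    then have "d W (be W) (ro V W) \<le> 2 * \<kappa> + \<xi> + 1 \<or> d V (be V) (ro W V) \<le> 2 * \<kappa> + \<xi> + 1"
      using be_ro b VW tsym by blast
    then show ?thesis using c0 E0 E' \<alpha> \<kappa> unfolding M_def by linarith
  qed
  \<comment> \<open>Unless \<open>x\<close> or the tuple is near \<open>ro V W\<close> in
    \<open>W\<close>, nested consistency puts \<open>pr V x\<close> near \<open>u\<close> and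
    \<open>be V\<close> near \<open>v\<close>, points in the images of \<open>pr W x\<close> and
    \<open>be W\<close>. Bounded geodesic image then either bounds the distance of \<open>u\<close>
    and \<open>v\<close>, or yields a point of the geodesic near \<open>ro V W\<close>, no farther
    from \<open>be W\<close> than \<open>pr W x\<close> is.\<close>
  have A3: "d V (pr V x) (be V) \<le> M \<or> d W (be W) (ro V W) \<le> d W (be W) (pr W x) + M"
    if x: "x \<in> points H" and be: "be \<in> Be" and VW: "V \<in> index H" "W \<in> index H" "psnested H V W"
    for x be V W
  proof -
    interpret V: Metric_space "cspace H V" "cdist H V" using met VW by blast
    interpret W: Metric_space "cspace H W" "cdist H W" using met VW by blast
    obtain b where b: "consistent_tuple H \<kappa> b" "\<forall>W\<in>index H. be W \<in> b W" using Bex[OF be] by blast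
    have beC: "be V \<in> cspace H V" "be W \<in> cspace H W" using b bC(1) VW by blast+
    have prx: "pr V x \<in> cspace H V" "pr W x \<in> cspace H W" using prC VW x by blast+
    have VW': "psnested H V W \<or> transverse H V W" using VW by blast
    have rmC: "rho_map H W V p \<subseteq> cspace H V" "rho_map H W V p \<noteq> {}" if "p \<in> cspace H W" for p
      using hn VW that unfolding hs_nesting_def by blast+
    obtain u where u: "u \<in> rho_map H W V (pr W x)" using rmC[OF prx(2)] by blast
    obtain v where v: "v \<in> rho_map H W V (be W)" using rmC[OF beC(2)] by blast
    have uv: "u \<in> cspace H V" "v \<in> cspace H V" using u v rmC prx beC by blast+
    have dWnn: "d W (be W) (pr W x) \<ge> 0" by (rule d_nonneg)
    have near: "d W (be W) (ro V W) \<le> d W (be W) (pr W x) + M"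
      if "d W (pr W x) (ro V W) \<le> 2 * \<xi> + \<kappa>\<^sub>0 + 1 \<or> d W (be W) (ro V W) \<le> 2 * \<kappa> + \<xi> + 1"
      using that dWnn d_tri[of W "be W" "ro V W" "pr W x"] c0 E0 E' \<alpha> \<kappa> unfolding M_def by linarith
    have "cset_dist H W (proj H W x) (rho_set H V W) \<le> ennreal \<kappa>\<^sub>0 \<or>
      cset_diam H V (proj H V x \<union> rho_image H W V (proj H W x)) \<le> ennreal \<kappa>\<^sub>0"
      using hc VW x unfolding hs_consistency_def min_le_iff_disj by blast
    then have "d W (pr W x) (ro V W) \<le> 2 * \<xi> + \<kappa>\<^sub>0 + 1 \<or> cdist H V (pr V x) u \<le> \<kappa>\<^sub>0"
    proof
      assume "cset_diam H V (proj H V x \<union> rho_image H W V (proj H W x)) \<le> ennreal \<kappa>\<^sub>0"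
      moreover have "u \<in> rho_image H W V (proj H W x)"
        using u prm[OF VW(2) x] unfolding rho_image_def by blast
      ultimately show ?thesis
        using set_diam_leD[of "cdist H V" _ \<kappa>\<^sub>0 "pr V x" u] c0 prm[OF VW(1) x]
        unfolding cset_diam_def by blast
    qed (use pr_ro[OF VW(1,2) VW' x c0(2)] in blast)
    moreover have "cset_dist H W (b W) (rho_set H V W) \<le> ennreal \<kappa> \<or>
      cset_diam H V (b V \<union> rho_image H W V (b W)) \<le> ennreal \<kappa>"
      using b(1) VW unfolding consistent_tuple_def min_le_iff_disj by blast
    then have "d W (be W) (ro V W) \<le> 2 * \<kappa> + \<xi> + 1 \<or> cdist H V (be V) v \<le> \<kappa>"
    proof
      assume "cset_diam H V (b V \<union> rho_image H W V (b W)) \<le> ennreal \<kappa>"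
      moreover have "v \<in> rho_image H W V (b W)" "be V \<in> b V"
        using v b(2) VW unfolding rho_image_def by blast+
      ultimately show ?thesis
        using set_diam_leD[of "cdist H V" _ \<kappa> "be V" v] \<kappa> unfolding cset_diam_def by auto
    qed (use be_ro[of b be W V] b VW VW' in blast)
    moreover have "cdist H V v u \<le> E' \<or> d W (be W) (ro V W) \<le> d W (be W) (pr W x) + M"
    proof -
      obtain L \<gamma> where \<gamma>: "geodesic_path (cspace H W) (cdist H W) L \<gamma>" "\<gamma> 0 = be W" "\<gamma> L = pr W x"
        using geo[OF VW(2)] beC prx unfolding geodesic_metric_space_def by blast
      have L: "L \<ge> 0" "\<gamma> t \<in> cspace H W" "cdist H W (be W) (\<gamma> t) \<le> cdist H W (be W) (pr W x)"
        if "t \<in> {0..L}" for t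
      proof -
        show "L \<ge> 0" "\<gamma> t \<in> cspace H W" using \<gamma>(1) that unfolding geodesic_path_def by auto
        then have "cdist H W (\<gamma> 0) (\<gamma> t) = \<bar>0 - t\<bar>" "cdist H W (\<gamma> 0) (\<gamma> L) = \<bar>0 - L\<bar>"
          using \<gamma>(1) that unfolding geodesic_path_def by auto
        then show "cdist H W (be W) (\<gamma> t) \<le> cdist H W (be W) (pr W x)" using \<gamma>(2,3) that by auto
      qed
      have L0: "L \<ge> 0" using \<gamma>(1) unfolding geodesic_path_def by blast
      consider "cset_diam H V (rho_image H W V (\<gamma> ` {0..L})) \<le> ennreal E'"
        | t where "t \<in> {0..L}" "cset_dist H W {\<gamma> t} (rho_set H V W) \<le> ennreal E'"
        using bgi VW \<gamma>(1) by blast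
      then show ?thesis
      proof cases
        case 1
        have "be W \<in> \<gamma> ` {0..L}" "pr W x \<in> \<gamma> ` {0..L}" using \<gamma>(2,3) L0 by force+
        then have "v \<in> rho_image H W V (\<gamma> ` {0..L})" "u \<in> rho_image H W V (\<gamma> ` {0..L})"
          using u v unfolding rho_image_def by blast+
        then show ?thesis
          using set_diam_leD[OF 1[unfolded cset_diam_def]] E' by simp
      next
        case (2 t)
        have "cdist H W (\<gamma> t) (ro V W) \<le> 0 + \<xi> + E' + 1"
          using set_dist_leD[OF met[OF VW(2)] _ rh(1)[OF VW(1,2) VW']
              set_diam_singleton[OF met[OF VW(2)] L(2)[OF 2(1)]] rh(2)[OF VW(1,2) VW']
              2(2)[unfolded cset_dist_def] _ c0(1) _ _ rom(1)[OF VW(1,2) VW'], of "\<gamma> t"]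
            L(2)[OF 2(1)] E' by simp
        moreover have "cdist H W (be W) (ro V W) \<le> cdist H W (be W) (\<gamma> t) + cdist H W (\<gamma> t) (ro V W)"
          using W.triangle beC L(2)[OF 2(1)] rom(2)[OF VW(1,2) VW'] by blast
        ultimately have "cdist H W (be W) (ro V W) \<le> cdist H W (be W) (pr W x) + \<xi> + E' + 1"
          using L(3)[OF 2(1)] by linarith
        then show ?thesis
          using d_eq[OF VW(2)] beC prx rom(2)[OF VW(1,2) VW'] c0 E0 \<alpha> \<kappa> unfolding M_def by simp
      qed
    qed
    moreover have "d V (pr V x) (be V) \<le> cdist H V (pr V x) u + cdist H V v u + cdist H V (be V) v"
      using d_eq[OF VW(1) prx(1) beC(1)] V.triangle[OF prx(1) uv(1) beC(1)]
        V.triangle[OF uv beC(1)] V.commute[of u v] V.commute[of v "be V"] by linarith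
    ultimately show ?thesis using near c0 E0 \<alpha> \<kappa> unfolding M_def by linarith
  qed
  have A4: "d W (ro U W) (ro V W) \<le> M"
    if I: "U \<in> index H" "V \<in> index H" "W \<in> index H" and UV: "nested H U V"
      and VW: "psnested H V W \<or> (transverse H V W \<and> \<not> orth H W U)" for U V W
  proof -
    have "nested H U W" if "psnested H V W"
      using that transp_onD[OF ord(3) I UV] unfolding psnested_def by blast
    moreover have "U \<noteq> W" if "psnested H V W"
      using that antisymp_onD[OF ord(2) I(2,3)] UV unfolding psnested_def by blast
    moreover have "\<not> nested H W U" if "transverse H V W"
      using that transp_onD[OF ord(3) I(3,1,2) _ UV] unfolding transverse_def by blast
    moreover have "U \<noteq> W" if "transverse H V W"
      using that UV unfolding transverse_def by blast
    moreover have "\<not> orth H U W" if "\<not> orth H W U" using that osym I by blast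
    ultimately have UW: "psnested H U W \<or> transverse H U W"
      using VW unfolding psnested_def transverse_def by blast
    have VW': "psnested H V W \<or> transverse H V W" using VW by blast
    have "cset_dist H W (rho_set H U W) (rho_set H V W) \<le> ennreal \<kappa>\<^sub>0"
      using hc I UV VW unfolding hs_consistency_def by blast
    then have "cdist H W (ro U W) (ro V W) \<le> \<xi> + \<xi> + \<kappa>\<^sub>0 + 1"
      using set_dist_leD[OF met[OF I(3)] rh(1)[OF I(1,3) UW] rh(1)[OF I(2,3) VW']
          rh(2)[OF I(1,3) UW] rh(2)[OF I(2,3) VW'] _ c0(1,1,2) rom(1)[OF I(1,3) UW]
          rom(1)[OF I(2,3) VW']] unfolding cset_dist_def by blast
    then show ?thesis
      using d_eq[OF I(3) rom(2)[OF I(1,3) UW] rom(2)[OF I(2,3) VW']] c0 E0 E' \<alpha> \<kappa>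
      unfolding M_def by linarith
  qed
  have A5: "\<exists>x\<in>points H. (\<forall>V\<in>F. d V (pr V x) (be V) \<le> M) \<and>
      (\<forall>V\<in>F. \<forall>W\<in>index H. \<not> orth H V W \<longrightarrow> \<not> nested H W V \<longrightarrow> d W (pr W x) (ro V W) \<le> M)"
    if be: "be \<in> Be" and F: "F \<subseteq> index H" "pairwise (orth H) F" for be F
  proof -
    obtain b where b: "consistent_tuple H \<kappa> b" "\<forall>W\<in>index H. be W \<in> b W" using Bex[OF be] by blast
    \<comment> \<open>Partial realization accepts only points of the projection image. Admissibility
      supplies one near \<open>b V\<close>, and the diameter of \<open>b V\<close> accounts for the
      second \<kappa>.\<close>
    have "\<exists>p. p \<in> proj_image H V \<and> p \<in> cspace H V \<and> d V p (be V) \<le> 2 * \<kappa> + 1"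
      if V: "V \<in> index H" for V
    proof -
      obtain \<beta> p where \<beta>: "\<beta> \<in> b V" "p \<in> proj_image H V" "cdist H V \<beta> p < \<kappa> + 1"
        using set_dist_le_obtain[OF bC(3)[OF b(1) V]] \<kappa> by (metis zero_le_one order_trans)
      have beV: "be V \<in> b V" using b V by blast
      have C: "p \<in> cspace H V" "\<beta> \<in> cspace H V" "be V \<in> cspace H V"
        using \<beta> beV bC(1)[OF b(1) V] pj(1)[OF V] unfolding proj_image_def by blast+
      have "cdist H V (be V) \<beta> \<le> \<kappa>" using set_diam_leD[OF bC(2)[OF b(1) V] _ beV \<beta>(1)] \<kappa> by simp
      then have "d V p (be V) \<le> 2 * \<kappa> + 1"
        using \<beta>(3) d_tri[of V "be V" p \<beta>] d_sym[of V p] d_eq[OF V] C by simp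
      then show ?thesis using \<beta> C by blast
    qed
    then obtain p where p: "\<And>V. V \<in> index H \<Longrightarrow>
        p V \<in> proj_image H V \<and> p V \<in> cspace H V \<and> d V (p V) (be V) \<le> 2 * \<kappa> + 1" by metis
    have "\<exists>x\<in>points H. (\<forall>V\<in>F. cset_dist H V (proj H V x) {p V} \<le> ennreal \<alpha>) \<and>
        (\<forall>V\<in>F. \<forall>W\<in>index H. psnested H V W \<or> transverse H W V \<longrightarrow>
          cset_dist H W (proj H W x) (rho_set H V W) \<le> ennreal \<alpha>)"
      by (rule pre[OF F(1)]) (use F p in \<open>auto dest: pairwiseD\<close>)
    then obtain x where x: "x \<in> points H" "\<forall>V\<in>F. cset_dist H V (proj H V x) {p V} \<le> ennreal \<alpha>"
       "\<forall>V\<in>F. \<forall>W\<in>index H. psnested H V W \<or> transverse H W V \<longrightarrow>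
              cset_dist H W (proj H W x) (rho_set H V W) \<le> ennreal \<alpha>"
      by (elim bexE conjE)
    have "d V (pr V x) (be V) \<le> M" if "V \<in> F" for V
    proof -
      have V: "V \<in> index H" using that F by blast
      have "cdist H V (pr V x) (p V) \<le> \<xi> + 0 + \<alpha> + 1"
        using set_dist_leD[OF met[OF V] pj(1)[OF V x(1)] _ pj(3)[OF V x(1)]
          set_diam_singleton[OF met[OF V]] x(2)[rule_format, OF that, unfolded cset_dist_def]
          c0(1) _ \<alpha> prm[OF V x(1)], of "p V"] p[OF V] by simp
      then show ?thesis
        using p[OF V] d_tri[of V "pr V x" "be V" "p V"] d_eq[OF V prC[OF V x(1)], of "p V"]
          c0 E0 E' \<kappa> unfolding M_def by linarith
    qed
    moreover have "d W (pr W x) (ro V W) \<le> M"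
      if V: "V \<in> F" and W: "W \<in> index H" "\<not> orth H V W" "\<not> nested H W V" for V W
    proof -
      have VI: "V \<in> index H" using V F by blast
      have rel: "psnested H V W \<or> transverse H V W"
        using W reflp_onD[OF ord(1) W(1)] unfolding psnested_def transverse_def by blast
      then have "cset_dist H W (proj H W x) (rho_set H V W) \<le> ennreal \<alpha>"
        using x(3) V W(1) tsym VI by blast
      then show ?thesis
        using pr_ro[OF VI W(1) rel x(1) \<alpha>] c0 E0 E' \<kappa> unfolding M_def by linarith
    qed
    ultimately show ?thesis using x(1) by blast
  qed
  \<comment> \<open>The distance of the projections is at most that of the chosen points, so
    \<open>R\<close> may replace it in the count of large links.\<close>
  define g where "g R = nat \<lfloor>\<Lambda> * R + \<Lambda>\<rfloor>" for R
  have A6: "\<exists>\<T>\<subseteq>index H. finite \<T> \<and> card \<T> \<le> g R \<and> (\<forall>T'\<in>\<T>. nested H T' W \<and> T' \<noteq> W) \<and>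
          (\<forall>T\<in>index H. nested H T W \<longrightarrow> T \<noteq> W \<longrightarrow> M < d T (pr T x) (pr T y) \<longrightarrow>
            (\<exists>T'\<in>\<T>. nested H T T'))"
    if W: "W \<in> index H" and x: "x \<in> points H" and y: "y \<in> points H"
      and R: "d W (pr W x) (pr W y) \<le> R" for W x y R
  proof -
    define N where "N = \<Lambda> * enn2real (proj_dist H W x y) + \<Lambda>"
    obtain \<T> where T: "\<T> \<subseteq> below H W - {W}" "finite \<T>" "int (card \<T>) \<le> \<lfloor>N\<rfloor>"
      "\<forall>T\<in>below H W - {W}. (\<exists>T'\<in>\<T>. T \<in> below H T') \<or> proj_dist H T x y < ennreal E"
      using ll[rule_format, OF W x y] unfolding N_def Let_def by blast
    have "proj_dist H W x y \<le> ennreal R"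
      using set_dist_le[OF prm[OF W x] prm[OF W y], of "cdist H W"] R
        d_eq[OF W prC[OF W x] prC[OF W y]] ennreal_leI
      unfolding proj_dist_def cset_dist_def by (metis order_trans)
    moreover have "R \<ge> 0" using R d_nonneg[of W "pr W x" "pr W y"] by linarith
    ultimately have "enn2real (proj_dist H W x y) \<le> R" by (simp add: enn2real_leI)
    then have "N \<le> \<Lambda> * R + \<Lambda>" using LE unfolding N_def by simp
    then have "\<lfloor>N\<rfloor> \<le> \<lfloor>\<Lambda> * R + \<Lambda>\<rfloor>" by (rule floor_mono)
    then have card: "card \<T> \<le> g R" using T(3) unfolding g_def by linarith
    have "\<exists>T'\<in>\<T>. nested H T T'"
      if t: "T \<in> index H" "nested H T W" "T \<noteq> W" "M < d T (pr T x) (pr T y)" for T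
    proof -
      have "\<not> proj_dist H T x y < ennreal E"
      proof
        assume "proj_dist H T x y < ennreal E"
        then have "set_dist (cdist H T) (proj H T x) (proj H T y) \<le> ennreal E"
          unfolding proj_dist_def cset_dist_def by simp
        then have "cdist H T (pr T x) (pr T y) \<le> \<xi> + \<xi> + E + 1"
          by (rule set_dist_leD[OF met[OF t(1)] pj(1)[OF t(1) x] pj(1)[OF t(1) y]
              pj(3)[OF t(1) x] pj(3)[OF t(1) y] _ c0(1,1) E0 prm[OF t(1) x] prm[OF t(1) y]])
        then show False
          using t(4) d_eq[OF t(1) prC[OF t(1) x] prC[OF t(1) y]] c0 E' \<alpha> \<kappa> unfolding M_def by linarith
      qed
      then show ?thesis using T(4) t unfolding below_def by blast
    qed
    then show ?thesis using T(1,2) card unfolding below_def by (intro exI[of _ \<T>]) blast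
  qed
  have A7: "\<exists>W\<in>index H. nested H W T \<and> W \<noteq> T \<and>
      (\<forall>V\<in>index H. nested H V T \<longrightarrow> orth H V U \<longrightarrow> nested H V W)"
    if "T \<in> index H" "U \<in> index H" "nested H U T" "V \<in> index H" "nested H V T" "orth H V U" for T U V
  proof -
    have "\<forall>T\<in>index H. \<forall>U\<in>below H T. {V \<in> below H T. orth H V U} \<noteq> {} \<longrightarrow>
        (\<exists>W\<in>below H T - {T}. \<forall>V\<in>below H T. orth H V U \<longrightarrow> nested H V W)"
      using ho unfolding hs_orthogonality_def by blast
    moreover have "U \<in> below H T" "{V \<in> below H T. orth H V U} \<noteq> {}"
      using that unfolding below_def by auto
    ultimately have "\<exists>W\<in>below H T - {T}. \<forall>V\<in>below H T. orth H V U \<longrightarrow> nested H V W"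
      using that(1) by blast
    then show ?thesis unfolding below_def by blast
  qed
  have A8: "orth H V U" if "V \<in> index H" "W \<in> index H" "U \<in> index H" "nested H V W" "orth H W U" for U V W
    using ho that unfolding hs_orthogonality_def by blast
  have A9: "\<not> nested H V W" if "V \<in> index H" "W \<in> index H" "orth H V W" for V W
    using ho that unfolding hs_orthogonality_def by blast
  have M1: "M \<ge> 1" using c0 E0 E' \<alpha> \<kappa> unfolding M_def by linarith

  interpret coarse_hierarchy "points H" "index H" "nested H" "orth H" d pr ro Be M g lev n
  proof (unfold_locales, goal_cases)
    case 1 show ?case by (rule d_sym)
  next
    case 2 show ?case by (rule d_tri)
  next
    case 3 show ?case by (rule M1)
  next
    case 4 then show ?case using reflp_onD[OF ord(1)] by blast
  next
    case 5 then show ?case using antisymp_onD[OF ord(2)] by blast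
  next
    case 6 then show ?case using transp_onD[OF ord(3)] by blast
  next
    case 7 then show ?case using osym by blast
  next
    case 8 then show ?case using A8 by blast
  next
    case 9 then show ?case using A9 by blast
  next
    case 10 then show ?case by (rule A7)
  next
    case 11 then show ?case using lev by blast
  next
    case 12 then show ?case using lev by blast
  next
    case 13 then show ?case using A1 unfolding transverse_def by blast
  next
    case 14 then show ?case using A2 unfolding transverse_def by blast
  next
    case 15 then show ?case using A3 unfolding psnested_def by blast
  next
    case 16 then show ?case using A4 unfolding psnested_def by blast
  next
    case 17 then show ?case using A4 unfolding transverse_def by blast
  next
    case 18 then show ?case by (rule A5)
  next
    case 19 then show ?case by (rule A6)
  qed

  have "\<exists>\<theta>. \<forall>be\<in>Be. \<exists>x\<in>points H. \<forall>W\<in>index H. d W (pr W x) (be W) \<le> \<theta>"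
  \<comment> \<open>Without indices there is no maximal element, and any point will do.\<close>
  proof (cases "index H = {}")
    case True
    then show ?thesis using x0 by blast
  next
    case False
    then obtain S where "S \<in> index H"
      "\<And>M. M \<in> index H \<Longrightarrow> (\<forall>V\<in>index H. nested H M V \<longrightarrow> V = M) \<Longrightarrow> M = S"
      using hn unfolding hs_nesting_def by blast
    then show ?thesis using maximal_is_greatest[of S] realization_point[of S] by blast
  qed
  then obtain \<theta> where \<theta>: "\<And>be. be \<in> Be \<Longrightarrow>
      \<exists>x\<in>points H. \<forall>W\<in>index H. d W (pr W x) (be W) \<le> \<theta>" by blast
  show ?thesis
  proof (intro exI[of _ "max \<theta> 0"] conjI allI impI)
    fix b assume b: "consistent_tuple H \<kappa> b"
    define be where "be W = (SOME p. p \<in> b W)" for W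
    have bem: "be W \<in> b W" if "W \<in> index H" for W
      using b that some_in_eq unfolding consistent_tuple_def be_def by blast
    then have "be \<in> Be" using b unfolding Be_def by blast
    then obtain x where x: "x \<in> points H" "\<forall>W\<in>index H. d W (pr W x) (be W) \<le> \<theta>" using \<theta> by blast
    have "cset_dist H W (b W) (proj H W x) \<le> ennreal (max \<theta> 0)" if W: "W \<in> index H" for W
    proof -
      have "be W \<in> cspace H W" using bem[OF W] bC(1)[OF b W] by blast
      then have "cdist H W (be W) (pr W x) = d W (pr W x) (be W)"
        using d_sym[of W "be W" "pr W x"] d_eq[OF W _ prC[OF W x(1)]] by simp
      then have "cdist H W (be W) (pr W x) \<le> \<theta>" using x(2) W by simp
      then have "ennreal (cdist H W (be W) (pr W x)) \<le> ennreal (max \<theta> 0)"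
        by (intro ennreal_leI) simp
      then show ?thesis
        using set_dist_le[OF bem[OF W] prm[OF W x(1)], of "cdist H W"] order_trans
        unfolding cset_dist_def by blast
    qed
    then show "\<exists>x\<in>points H. \<forall>W\<in>index H. cset_dist H W (b W) (proj H W x) \<le> ennreal (max \<theta> 0)"
      using x(1) by blast
  qed simp
qed

section \<open>Coarse uniqueness\<close>

lemma coarse_uniqueness:
  fixes H :: "('x, 's, 'c) hierarchy"
  assumes H: "hierarchical_space q H" and \<kappa>: "\<kappa> \<ge> 0" and \<theta>: "\<theta> \<ge> 0"
  shows "\<exists>\<theta>\<^sub>u\<ge>0. \<forall>b. consistent_tuple H \<kappa> b \<longrightarrow>
    set_diam (pdist H)
      {x \<in> points H. \<forall>W\<in>index H. cset_dist H W (b W) (proj H W x) \<le> ennreal \<theta>} \<le> ennreal \<theta>\<^sub>u"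
proof -
  \<comment> \<open>Passing from the projection of \<open>x\<close> to that of \<open>y\<close>
    through two points of \<open>b V\<close> costs less than
    \<open>2 * \<theta> + \<kappa> + 2\<close>, so two realizing points never reach distance
    \<open>R\<close> in any coordinate.\<close>
  define R where "R = 2 * \<theta> + \<kappa> + 3"
  have R: "R \<ge> 0" using \<kappa> \<theta> unfolding R_def by simp
  have "hs_uniqueness H" using H unfolding hierarchical_space_def by blast
  then obtain \<theta>\<^sub>u where u: "\<And>x y. x \<in> points H \<Longrightarrow> y \<in> points H \<Longrightarrow> pdist H x y \<ge> \<theta>\<^sub>u \<Longrightarrow>
      \<exists>V\<in>index H. proj_dist H V x y \<ge> ennreal R"
    using R unfolding hs_uniqueness_def by blast
  show ?thesis
  proof (intro exI[of _ "max \<theta>\<^sub>u 0"] conjI allI impI)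
    fix b assume b: "consistent_tuple H \<kappa> b"
    have "pdist H x y \<le> \<theta>\<^sub>u"
      if x: "x \<in> points H" "\<And>W. W \<in> index H \<Longrightarrow> cset_dist H W (b W) (proj H W x) \<le> ennreal \<theta>"
        and y: "y \<in> points H" "\<And>W. W \<in> index H \<Longrightarrow> cset_dist H W (b W) (proj H W y) \<le> ennreal \<theta>"
      for x y
    proof (rule ccontr)
      assume "\<not> ?thesis"
      then obtain V where V: "V \<in> index H" "proj_dist H V x y \<ge> ennreal R"
        using u[OF x(1) y(1)] by auto
      interpret Metric_space "cspace H V" "cdist H V"
        using H V(1) unfolding hierarchical_space_def geodesic_metric_space_def by blast
      have C: "b V \<subseteq> cspace H V" "set_diam (cdist H V) (b V) \<le> ennreal \<kappa>"
        using b V(1) unfolding consistent_tuple_def cset_diam_def by blast+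
      have P: "proj H V z \<subseteq> cspace H V" if "z \<in> points H" for z
        using H V(1) that unfolding hierarchical_space_def hs_projections_def by blast
      obtain a p where a: "a \<in> b V" "p \<in> proj H V x" "cdist H V a p < \<theta> + 1"
        using set_dist_le_obtain[OF x(2)[OF V(1), unfolded cset_dist_def] \<theta>] .
      obtain a' p' where a': "a' \<in> b V" "p' \<in> proj H V y" "cdist H V a' p' < \<theta> + 1"
        using set_dist_le_obtain[OF y(2)[OF V(1), unfolded cset_dist_def] \<theta>] .
      have I: "a \<in> cspace H V" "a' \<in> cspace H V" "p \<in> cspace H V" "p' \<in> cspace H V"
        using a a' C(1) P x(1) y(1) by blast+
      have "cdist H V a a' \<le> \<kappa>" using set_diam_leD[OF C(2) \<kappa> a(1) a'(1)] .
      then have "cdist H V p p' < R"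
        using a(3) a'(3) triangle[OF I(3,1,4)] triangle[OF I(1,2,4)] commute[of p a]
        unfolding R_def by linarith
      then have "ennreal (cdist H V p p') < ennreal R" using R_def \<kappa> \<theta> by (intro ennreal_lessI) auto
      moreover have "proj_dist H V x y \<le> ennreal (cdist H V p p')"
        using set_dist_le[OF a(2) a'(2)] unfolding proj_dist_def cset_dist_def .
      ultimately show False using V(2) by simp
    qed
    then have "ennreal (pdist H x y) \<le> ennreal (max \<theta>\<^sub>u 0)"
      if "x \<in> {x \<in> points H. \<forall>W\<in>index H. cset_dist H W (b W) (proj H W x) \<le> ennreal \<theta>}"
        "y \<in> {x \<in> points H. \<forall>W\<in>index H. cset_dist H W (b W) (proj H W x) \<le> ennreal \<theta>}" for x y
      using that by (intro ennreal_leI) (simp add: le_max_iff_disj)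
    then show "set_diam (pdist H)
      {x \<in> points H. \<forall>W\<in>index H. cset_dist H W (b W) (proj H W x) \<le> ennreal \<theta>} \<le> ennreal (max \<theta>\<^sub>u 0)"
      unfolding set_diam_def by (intro SUP_least)
  qed simp
qed

theorem theorem3p1:
  fixes H :: "('x, 's, 'c) hierarchy" and q \<kappa> :: real
  assumes "hierarchical_space q H" and "\<kappa> \<ge> 1"
  shows "\<exists>\<theta>\<^sub>e\<ge>0. \<exists>\<theta>\<^sub>u\<ge>0. \<forall>b. consistent_tuple H \<kappa> b \<longrightarrow>
    (\<exists>x\<in>points H. \<forall>W\<in>index H. cset_dist H W (b W) (proj H W x) \<le> ennreal \<theta>\<^sub>e) \<and>
    set_diam (pdist H)
      {x \<in> points H. \<forall>W\<in>index H. cset_dist H W (b W) (proj H W x) \<le> ennreal \<theta>\<^sub>e}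
      \<le> ennreal \<theta>\<^sub>u"
proof -
  obtain \<theta>\<^sub>e where e: "\<theta>\<^sub>e \<ge> 0" "\<forall>b. consistent_tuple H \<kappa> b \<longrightarrow>
    (\<exists>x\<in>points H. \<forall>W\<in>index H. cset_dist H W (b W) (proj H W x) \<le> ennreal \<theta>\<^sub>e)"
    using realization_bound[OF assms] by blast
  have "\<kappa> \<ge> 0" using assms(2) by simp
  from coarse_uniqueness[OF assms(1) this e(1)] e show ?thesis by blast
qed

end
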